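(* Let $d$ be prime, $n\ge1$, $G$ invertible over $\mathbb Z_d$, and $\rho_A,\rho_B$ $n$-qudit states. (1) If $G$ is odd-parity positive, $J(\rho_A\boxtimes\rho_B)\le J(\rho_B)$. (2) If $G$ is even-parity positive, $J(\rho_A\boxtimes\rho_B)\le J(\rho_A)$. (3) If $G$ is positive, $J(\rho_A\boxtimes\rho_B)\le\min\{J(\rho_A),J(\rho_B)\}$.
   Context: Fix a prime $d$; $\chi(k)=e^{2\pi ik/d}$, Pauli operators $X|k\rangle=|k+1\rangle$, $Z|k\rangle=\chi(k)|k\rangle$ on $\mathbb C^d$; $X_k,Z_k$ act on the $k$-th of $n$ qudits. For $R\in\{X_k,Z_k\}$ let $|j\rangle_R$ be the eigenvector of $R$ with eigenvalue $\chi(j)$, $H^R_j=|j\rangle\langle j|_R$, and $\Delta_R(\rho)=\sum_j{}_R\langle j|\rho|j\rangle_R\,|j\rangle\langle j|_R$. For a Hermitian $H$, $J(\rho;H)=\mathrm{Tr}[\rho[H,[H,\log\rho]]]$, and $J(\rho)=\sum_{k=1}^n\sum_{j}\big(J(\rho;H^{X_k}_j)+J(\rho;H^{Z_k}_j)\big)$; equivalently $J(\rho)=2\sum_{k=1}^n\sum_{R\in\{X_k,Z_k\}}\big(D(\rho\|\Delta_R\rho)+D(\Delta_R\rho\|\rho)\big)$ with $D$ the Umegaki relative entropy (possibly $+\infty$), which is used as the definition for non-faithful $\rho$. $G=\begin{pmatrix}g_{00}&g_{01}\\ g_{10}&g_{11}\end{pmatrix}$ over $\mathbb Z_d$, $\det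 G\not\equiv 0$, $N=(\det G)^{-1}$; nontrivial if at most one entry is $0$ mod $d$; odd-parity positive if nontrivial and $g_{01},g_{10}\not\equiv0$; even-parity positive if nontrivial and $g_{00},g_{11}\not\equiv0$; positive if both. Key unitary $U|\vec i\rangle|\vec j\rangle=|Ng_{11}\vec i-Ng_{10}\vec j\rangle|-Ng_{01}\vec i+Ng_{00}\vec j\rangle$; $\rho\boxtimes\sigma=\mathrm{Tr}_B[U(\rho\otimes\sigma)U^\dagger]$. *)

theory Defs
  imports Complex_Main "HOL-Library.Extended_Real" "Jordan_Normal_Form.Matrix"
begin

definition adj :: "complex mat \<Rightarrow> complex mat" where
  "adj A = mat (dim_col A) (dim_row A) (\<lambda>(i,j). cnj (A $$ (j,i)))"

definition tr :: "complex mat \<Rightarrow> complex" where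
  "tr A = (\<Sum>i<dim_row A. A $$ (i,i))"

definition hermitian :: "nat \<Rightarrow> complex mat \<Rightarrow> bool" where
  "hermitian D A \<longleftrightarrow> A \<in> carrier_mat D D \<and> adj A = A"

definition unitary :: "nat \<Rightarrow> complex mat \<Rightarrow> bool" where
  "unitary D U \<longleftrightarrow> U \<in> carrier_mat D D \<and> U * adj U = 1\<^sub>m D \<and> adj U * U = 1\<^sub>m D"

definition psd :: "nat \<Rightarrow> complex mat \<Rightarrow> bool" where
  "psd D A \<longleftrightarrow> hermitian D A \<and>
     (\<forall>v \<in> carrier_vec D. let z = conjugate v \<bullet> (A *\<^sub>v v) in Im z = 0 \<and> Re z \<ge> 0)"

definition density :: "nat \<Rightarrow> complex mat \<Rightarrow> bool" where
  "density D \<rho> \<longleftrightarrow> psd D \<rho> \<and> tr \<rho> = 1"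

definition rdiag :: "nat \<Rightarrow> (nat \<Rightarrow> real) \<Rightarrow> complex mat" where
  "rdiag D l = mat D D (\<lambda>(i,j). if i = j then complex_of_real (l i) else 0)"

text \<open>Functional calculus for Hermitian matrices via a spectral decomposition
  A = U diag(l) U^dagger (the result does not depend on the chosen decomposition).\<close>
definition matfun :: "nat \<Rightarrow> (real \<Rightarrow> real) \<Rightarrow> complex mat \<Rightarrow> complex mat" where
  "matfun D f A = (let (U, l) = (SOME (U, l). unitary D U \<and> A = U * rdiag D l * adj U)
                    in U * rdiag D (f \<circ> l) * adj U)"

text \<open>Logarithm on the support (log 0 := 0, i.e. log restricted to the support).\<close>
definition logz :: "real \<Rightarrow> real" where
  "logz x = (if x > 0 then ln x else 0)"

text \<open>Umegaki relative entropy D(rho||sigma) = Tr rho (log rho - log sigma) if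
  supp rho \<subseteq> supp sigma (i.e. ker sigma \<subseteq> ker rho), and +infinity otherwise.\<close>
definition rel_ent :: "nat \<Rightarrow> complex mat \<Rightarrow> complex mat \<Rightarrow> ereal" where
  "rel_ent D \<rho> \<sigma> =
    (if \<forall>v \<in> carrier_vec D. \<sigma> *\<^sub>v v = 0\<^sub>v D \<longrightarrow> \<rho> *\<^sub>v v = 0\<^sub>v D
     then ereal (Re (tr (\<rho> * (matfun D logz \<rho> - matfun D logz \<sigma>))))
     else \<infinity>)"

text \<open>Computational basis of (C^d)^{\<otimes> n} indexed by i < d^n; the k-th qudit
  (k = 0..n-1) carries the k-th base-d digit of i.\<close>
definition digit :: "nat \<Rightarrow> nat \<Rightarrow> nat \<Rightarrow> nat" where
  "digit d i k = (i div d ^ k) mod d"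

definition enc :: "nat \<Rightarrow> nat \<Rightarrow> (nat \<Rightarrow> nat) \<Rightarrow> nat" where
  "enc d n a = (\<Sum>k<n. a k * d ^ k)"

definition chi :: "nat \<Rightarrow> int \<Rightarrow> complex" where
  "chi d x = cis (2 * pi * of_int x / real d)"

definition pauliX :: "nat \<Rightarrow> nat \<Rightarrow> nat \<Rightarrow> complex mat" where
  "pauliX d n k = mat (d ^ n) (d ^ n) (\<lambda>(r,c).
     if digit d r k = (digit d c k + 1) mod d \<and> (\<forall>l<n. l \<noteq> k \<longrightarrow> digit d r l = digit d c l)
     then 1 else 0)"

definition pauliZ :: "nat \<Rightarrow> nat \<Rightarrow> nat \<Rightarrow> complex mat" where
  "pauliZ d n k = mat (d ^ n) (d ^ n) (\<lambda>(r,c).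
     if r = c then chi d (int (digit d c k)) else 0)"

text \<open>Spectral projector of R (with R^d = 1) onto its chi(j)-eigenspace:
  H^R_j = (1/d) \<Sum>_{m<d} chi(-jm) R^m.\<close>
definition eigproj :: "nat \<Rightarrow> nat \<Rightarrow> complex mat \<Rightarrow> nat \<Rightarrow> complex mat" where
  "eigproj d n R j = mat (d ^ n) (d ^ n) (\<lambda>(r,c).
     (\<Sum>m<d. chi d (- (int j * int m)) * (R ^\<^sub>m m) $$ (r,c)) / of_nat d)"

definition dephase :: "nat \<Rightarrow> nat \<Rightarrow> complex mat \<Rightarrow> complex mat \<Rightarrow> complex mat" where
  "dephase d n R \<rho> = mat (d ^ n) (d ^ n) (\<lambda>(r,c).
     (\<Sum>j<d. (eigproj d n R j * \<rho> * eigproj d n R j) $$ (r,c)))"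

definition Jfun :: "nat \<Rightarrow> nat \<Rightarrow> complex mat \<Rightarrow> ereal" where
  "Jfun d n \<rho> = 2 * (\<Sum>k<n.
      (rel_ent (d ^ n) \<rho> (dephase d n (pauliX d n k) \<rho>)
        + rel_ent (d ^ n) (dephase d n (pauliX d n k) \<rho>) \<rho>)
    + (rel_ent (d ^ n) \<rho> (dephase d n (pauliZ d n k) \<rho>)
        + rel_ent (d ^ n) (dephase d n (pauliZ d n k) \<rho>) \<rho>))"

definition detG :: "int mat \<Rightarrow> int" where
  "detG G = G $$ (0,0) * G $$ (1,1) - G $$ (0,1) * G $$ (1,0)"

definition invertible_mod :: "nat \<Rightarrow> int mat \<Rightarrow> bool" where
  "invertible_mod d G \<longleftrightarrow> G \<in> carrier_mat 2 2 \<and> \<not> int d dvd detG G"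

definition Ninv :: "nat \<Rightarrow> int mat \<Rightarrow> int" where
  "Ninv d G = (SOME N. (N * detG G) mod int d = 1 mod int d)"

definition nontrivial :: "nat \<Rightarrow> int mat \<Rightarrow> bool" where
  "nontrivial d G \<longleftrightarrow> card {(i,j). i < 2 \<and> j < 2 \<and> int d dvd G $$ (i,j)} \<le> 1"

definition odd_pos :: "nat \<Rightarrow> int mat \<Rightarrow> bool" where
  "odd_pos d G \<longleftrightarrow> nontrivial d G \<and> \<not> int d dvd G $$ (0,1) \<and> \<not> int d dvd G $$ (1,0)"

definition even_pos :: "nat \<Rightarrow> int mat \<Rightarrow> bool" where
  "even_pos d G \<longleftrightarrow> nontrivial d G \<and> \<not> int d dvd G $$ (0,0) \<and> \<not> int d dvd G $$ (1,1)"

definition positive :: "nat \<Rightarrow> int mat \<Rightarrow> bool" where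
  "positive d G \<longleftrightarrow> odd_pos d G \<and> even_pos d G"

text \<open>Tensor product on 2n qudits: index of |i>|j> is i * d^n + j (system A first).\<close>
definition kron :: "complex mat \<Rightarrow> complex mat \<Rightarrow> complex mat" where
  "kron A B = mat (dim_row A * dim_row B) (dim_col A * dim_col B)
     (\<lambda>(r,c). A $$ (r div dim_row B, c div dim_col B) * B $$ (r mod dim_row B, c mod dim_col B))"

definition keyperm :: "nat \<Rightarrow> nat \<Rightarrow> int mat \<Rightarrow> nat \<Rightarrow> nat" where
  "keyperm d n G c = (let D = d ^ n; i = c div D; j = c mod D; N = Ninv d G;
      a = (\<lambda>k. nat ((N * G $$ (1,1) * int (digit d i k) - N * G $$ (1,0) * int (digit d j k)) mod int d));
      b = (\<lambda>k. nat ((- N * G $$ (0,1) * int (digit d i k) + N * G $$ (0,0) * int (digit d j k)) mod int d))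
    in enc d n a * D + enc d n b)"

definition keyU :: "nat \<Rightarrow> nat \<Rightarrow> int mat \<Rightarrow> complex mat" where
  "keyU d n G = mat (d ^ n * d ^ n) (d ^ n * d ^ n) (\<lambda>(r,c). if r = keyperm d n G c then 1 else 0)"

definition ptrB :: "nat \<Rightarrow> complex mat \<Rightarrow> complex mat" where
  "ptrB D M = mat D D (\<lambda>(r,c). \<Sum>t<D. M $$ (r * D + t, c * D + t))"

definition boxtimes :: "nat \<Rightarrow> nat \<Rightarrow> int mat \<Rightarrow> complex mat \<Rightarrow> complex mat \<Rightarrow> complex mat" where
  "boxtimes d n G \<rho> \<sigma> = ptrB (d ^ n) (keyU d n G * kron \<rho> \<sigma> * adj (keyU d n G))"

end

theory Submission
  imports Defs "Jordan_Normal_Form.Schur_Decomposition" "Jordan_Normal_Form.Spectral_Radius"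
    "HOL-Number_Theory.Cong"
begin

text \<open>
  For fixed \<open>\<rho>\<^sub>B\<close> the map \<open>\<rho>\<^sub>A \<mapsto> \<rho>\<^sub>A \<boxtimes> \<rho>\<^sub>B\<close> is a quantum channel. It sends conjugation by \<open>X\<^sub>k\<close> and
  \<open>Z\<^sub>k\<close> to conjugation by powers of \<open>X\<^sub>k\<close> and \<open>Z\<^sub>k\<close>, with exponents that are invertible
  modulo \<open>d\<close> when \<open>g\<^sub>1\<^sub>1\<close> and \<open>g\<^sub>0\<^sub>0\<close> are, so it commutes with the dephasing maps; by symmetry the
  same holds in \<open>\<rho>\<^sub>B\<close> when \<open>g\<^sub>1\<^sub>0\<close> and \<open>g\<^sub>0\<^sub>1\<close> are invertible. Each summand of \<open>J\<close> then decreases by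
  the data processing inequality.

  The data processing inequality is reduced to a derivative in one real variable. If
  \<open>\<rho> = \<Sum> p\<^sub>i |u\<^sub>i\<rangle>\<langle>u\<^sub>i|\<close>, \<open>\<sigma> = \<Sum> q\<^sub>j |w\<^sub>j\<rangle>\<langle>w\<^sub>j|\<close> and \<open>w\<^sub>i\<^sub>j = |\<langle>u\<^sub>i|w\<^sub>j\<rangle>|\<^sup>2\<close>, then \<open>D(\<rho>\<parallel>\<sigma>)\<close> is the
  renormalised increment over \<open>0 < t < \<infinity>\<close> of \<open>\<Sum> w\<^sub>i\<^sub>j p\<^sub>i ln (q\<^sub>j + t p\<^sub>i)\<close>. Its derivative
  \<open>\<Sum> w\<^sub>i\<^sub>j p\<^sub>i\<^sup>2 / (q\<^sub>j + t p\<^sub>i)\<close> is the supremum over \<open>X\<close> of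
  \<open>2 Re Tr \<rho>X - t Tr \<rho>XX\<^sup>* - Tr \<sigma>X\<^sup>*X\<close>, which decreases under channels because the dual map
  satisfies the Kadison--Schwarz inequality.
\<close>

section \<open>Spectral theorem for Hermitian matrices\<close>

lemma adj_dim [simp]: "dim_row (adj A) = dim_col A" "dim_col (adj A) = dim_row A"
  by (auto simp: adj_def)

lemma adj_carrier [simp, intro]: "A \<in> carrier_mat n m \<Longrightarrow> adj A \<in> carrier_mat m n"
  by (auto simp: adj_def)

lemma adj_index [simp]: "i < dim_col A \<Longrightarrow> j < dim_row A \<Longrightarrow> adj A $$ (i,j) = cnj (A $$ (j,i))"
  by (auto simp: adj_def)

lemma adj_adj [simp]: "adj (adj A) = A"
  by (rule eq_matI) auto

lemma mult_index_sum:
  assumes "A \<in> carrier_mat n m" "B \<in> carrier_mat m k" "i < n" "j < k"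
  shows "(A * B) $$ (i,j) = (\<Sum>l<m. A $$ (i,l) * B $$ (l,j))"
  using assms by (auto simp: scalar_prod_def atLeast0LessThan intro!: sum.cong)

lemma adj_mult:
  assumes "A \<in> carrier_mat n m" "B \<in> carrier_mat m k"
  shows "adj (A * B) = adj B * adj A"
proof (rule eq_matI)
  fix i j assume "i < dim_row (adj B * adj A)" "j < dim_col (adj B * adj A)"
  then have ij: "i < k" "j < n" using assms by auto
  have "adj (A * B) $$ (i,j) = cnj (\<Sum>l<m. A $$ (j,l) * B $$ (l,i))"
    using assms ij by (subst adj_index) (auto simp: mult_index_sum simp del: index_mult_mat(1))
  also have "\<dots> = (\<Sum>l<m. adj B $$ (i,l) * adj A $$ (l,j))"
    using assms ij by (auto simp: mult.commute intro!: sum.cong)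
  finally show "adj (A * B) $$ (i,j) = (adj B * adj A) $$ (i,j)"
    using assms ij by (subst mult_index_sum[of _ k m _ n]) auto
qed (use assms in auto)

lemma mult_assoc_dim:
  fixes A :: "'a::semiring_0 mat"
  assumes "dim_col A = dim_row B" "dim_col B = dim_row C"
  shows "(A * B) * C = A * (B * C)"
  by (rule assoc_mult_mat[of A "dim_row A" "dim_col A" B "dim_col B" C "dim_col C"]) (use assms in auto)

lemma adj_mult_dim: "dim_col A = dim_row B \<Longrightarrow> adj (A * B) = adj B * adj A"
  by (rule adj_mult[of A "dim_row A" "dim_col A" B "dim_col B"]) auto

lemma adj_minus:
  assumes "A \<in> carrier_mat n m" "B \<in> carrier_mat n m"
  shows "adj (A - B) = adj A - adj B"
  by (rule eq_matI) (use assms in auto)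

lemma rdiag_carrier [simp, intro]: "rdiag D l \<in> carrier_mat D D"
  by (auto simp: rdiag_def)

lemma rdiag_dim [simp]: "dim_row (rdiag D l) = D" "dim_col (rdiag D l) = D"
  by (auto simp: rdiag_def)

lemma rdiag_index [simp]:
  "i < D \<Longrightarrow> j < D \<Longrightarrow> rdiag D l $$ (i,j) = (if i = j then complex_of_real (l i) else 0)"
  by (auto simp: rdiag_def)

lemma adj_rdiag [simp]: "adj (rdiag D l) = rdiag D l"
  by (rule eq_matI) auto

lemma tr_mult:
  assumes "A \<in> carrier_mat n m" "B \<in> carrier_mat m n"
  shows "tr (A * B) = (\<Sum>i<n. \<Sum>l<m. A $$ (i,l) * B $$ (l,i))"
  unfolding tr_def using assms mult_index_sum[OF assms] by (auto intro!: sum.cong simp del: index_mult_mat(1))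

lemma tr_comm:
  assumes "A \<in> carrier_mat n m" "B \<in> carrier_mat m n"
  shows "tr (A * B) = tr (B * A)"
  unfolding tr_mult[OF assms] tr_mult[OF assms(2,1)]
  by (subst sum.swap) (auto simp: mult.commute)

lemma tr_minus:
  assumes "A \<in> carrier_mat n n" "B \<in> carrier_mat n n"
  shows "tr (A - B) = tr A - tr B"
  using assms by (auto simp: tr_def sum_subtractf)

lemma unitaryI:
  assumes "U \<in> carrier_mat n n" "adj U * U = 1\<^sub>m n"
  shows "unitary n U"
  using assms mat_mult_left_right_inverse[OF adj_carrier[OF assms(1)] assms(1,2)]
  by (auto simp: unitary_def)

lemma unitary_mult:
  assumes "unitary n U" "unitary n V"
  shows "unitary n (U * V)"
proof (rule unitaryI)
  have c: "U \<in> carrier_mat n n" "V \<in> carrier_mat n n" using assms by (auto simp: unitary_def)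
  then show "U * V \<in> carrier_mat n n" by auto
  have "adj (U * V) * (U * V) = adj V * (adj U * U) * V"
    using c by (simp add: adj_mult_dim mult_assoc_dim)
  then show "adj (U * V) * (U * V) = 1\<^sub>m n"
    using assms c by (auto simp: unitary_def)
qed

text \<open>Complete \<open>v\<close> to a basis and orthogonalise it. Gram-Schmidt leaves the first
  vector unchanged, so normalising the columns gives a unitary that starts with a multiple of
  \<open>v\<close>.\<close>

lemma unitary_first_column:
  fixes v :: "complex vec"
  assumes v: "v \<in> carrier_vec n" "v \<noteq> 0\<^sub>v n" and n: "n \<noteq> 0"
  obtains W c where "unitary n W" "col W 0 = c \<cdot>\<^sub>v v" 
proof -
  interpret cof_vec_space n "TYPE(complex)" .
  define b where "b = basis_completion v"
  define ws where "ws = gram_schmidt n b"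
  from basis_completion[OF v, folded b_def]
  have b: "distinct b" "\<not> lin_dep (set b)" "set b \<subseteq> carrier_vec n" "hd b = v" "length b = n"
    by auto
  then obtain vs where bv: "b = v # vs" using n by (cases b) auto
  from gram_schmidt_result[OF b(3,1,2) refl, folded ws_def]
  have ws: "set ws \<subseteq> carrier_vec n" "corthogonal ws" "length ws = n" by (auto simp: b)
  from gram_schmidt_hd[OF v(1), of vs, folded bv] have hdws: "hd ws = v" unfolding ws_def .
  then have ws0: "ws ! 0 = v" using ws n by (cases ws) auto
  have wsc: "ws ! i \<in> carrier_vec n" if "i < n" for i using ws that by auto
  define s where "s i = (\<Sum>l<n. (cmod (ws ! i $ l))\<^sup>2)" for i
  have ip: "ws ! i \<bullet>c ws ! j = (\<Sum>l<n. ws ! i $ l * cnj (ws ! j $ l))" if "i < n" "j < n" for i j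
    using wsc[OF that(1)] wsc[OF that(2)]
    by (auto simp: scalar_prod_def atLeast0LessThan intro!: sum.cong)
  have ii: "ws ! i \<bullet>c ws ! i = complex_of_real (s i)" if "i < n" for i
    using that by (simp add: ip s_def complex_norm_square del: of_real_power)
  \<comment> \<open>\<open>corthogonal\<close> also says that no vector is orthogonal to itself, so
    the squared norm \<open>s i\<close> is nonzero.\<close>
  have s_pos: "s i > 0" if "i < n" for i
  proof -
    have "s i \<noteq> 0" using corthogonalD[OF ws(2), of i i] ii[OF that] that ws(3) by auto
    moreover have "s i \<ge> 0" by (auto simp: s_def intro: sum_nonneg)
    ultimately show ?thesis by simp
  qed
  define W where "W = mat n n (\<lambda>(l,i). ws ! i $ l / complex_of_real (sqrt (s i)))"
  have W: "W \<in> carrier_mat n n" by (auto simp: W_def)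
  have "adj W * W = 1\<^sub>m n"
  proof (rule eq_matI)
    fix i j assume "i < dim_row (1\<^sub>m n :: complex mat)" "j < dim_col (1\<^sub>m n :: complex mat)"
    then have ij: "i < n" "j < n" by auto
    have "(adj W * W) $$ (i,j) = (\<Sum>l<n. adj W $$ (i,l) * W $$ (l,j))"
      using W ij by (intro mult_index_sum) auto
    also have "\<dots> = (\<Sum>l<n. ws ! j $ l * cnj (ws ! i $ l)) / complex_of_real (sqrt (s i) * sqrt (s j))"
      using ij W by (auto simp: W_def sum_divide_distrib intro!: sum.cong)
    also have "\<dots> = ws ! j \<bullet>c ws ! i / complex_of_real (sqrt (s i) * sqrt (s j))"
      using ip[OF ij(2,1)] by simp
    also have "\<dots> = (if i = j then 1 else 0)"
    proof (cases "i = j")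
      case True
      then show ?thesis using ii[OF ij(1)] s_pos[OF ij(1)] by (simp flip: of_real_mult)
    next
      case False
      then show ?thesis using corthogonalD[OF ws(2), of j i] ij ws(3) by simp
    qed
    finally show "(adj W * W) $$ (i,j) = 1\<^sub>m n $$ (i,j)" using ij by simp
  qed (use W in auto)
  then have "unitary n W" using W by (intro unitaryI)
  moreover have "col W 0 = (1 / complex_of_real (sqrt (s 0))) \<cdot>\<^sub>v v"
    using n v wsc[of 0] ws0 by (intro eq_vecI) (auto simp: W_def)
  ultimately show thesis by (rule that)
qed

lemma hermitian_unitary_conj:
  assumes "hermitian n A" "U \<in> carrier_mat n n"
  shows "hermitian n (adj U * A * U)"
proof -
  have A: "A \<in> carrier_mat n n" "adj A = A" using assms by (auto simp: hermitian_def)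
  have "adj (adj U * A * U) = adj U * A * U"
    using A assms(2) by (simp add: adj_mult_dim mult_assoc_dim)
  then show ?thesis using A(1) assms(2) by (auto simp: hermitian_def)
qed

lemma unitary_conj_cancel:
  assumes "unitary n U" "A \<in> carrier_mat n n"
  shows "U * (adj U * A * U) * adj U = A"
proof -
  have c: "U \<in> carrier_mat n n" "adj U \<in> carrier_mat n n" and u: "U * adj U = 1\<^sub>m n"
    using assms by (auto simp: unitary_def)
  have "U * (adj U * A * U) * adj U = (U * adj U) * A * (U * adj U)"
    using c assms(2) by (simp add: mult_assoc_dim)
  then show ?thesis using u assms(2) by auto
qed

text \<open>Deflation by induction on the dimension: in an orthonormal basis starting with an
  eigenvector, the first column is a multiple of the first unit vector, hermiticity gives the same
  for the first row, and the remaining block is hermitian and smaller.\<close>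

lemma spectral_theorem_hermitian:
  assumes "hermitian n A"
  shows "\<exists>U l. unitary n U \<and> A = U * rdiag n l * adj U"
  using assms
proof (induction n arbitrary: A)
  case 0
  then show ?case
    by (intro exI[of _ "1\<^sub>m 0"] exI[of _ "\<lambda>_. 0"])
      (auto simp: hermitian_def unitary_def intro!: eq_matI)
next
  case (Suc n)
  let ?m = "Suc n"
  have A: "A \<in> carrier_mat ?m ?m" using Suc.prems by (simp add: hermitian_def)
  obtain e where "eigenvalue A e" using spectrum_non_empty[OF A] by (auto simp: spectrum_def)
  then obtain v where v: "v \<in> carrier_vec ?m" "v \<noteq> 0\<^sub>v ?m" "A *\<^sub>v v = e \<cdot>\<^sub>v v"
    using A by (auto simp: eigenvalue_def eigenvector_def)
  obtain W c where W: "unitary ?m W" "col W 0 = c \<cdot>\<^sub>v v" by (rule unitary_first_column[OF v(1,2)]) auto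
  have Wc: "W \<in> carrier_mat ?m ?m" and WW: "adj W * W = 1\<^sub>m ?m" using W by (auto simp: unitary_def)
  define B where "B = adj W * A * W"
  have B: "B \<in> carrier_mat ?m ?m" using A Wc by (auto simp: B_def)
  have hB: "hermitian ?m B" unfolding B_def by (rule hermitian_unitary_conj[OF Suc.prems Wc])
  then have Bsym: "B $$ (i,j) = cnj (B $$ (j,i))" if "i < ?m" "j < ?m" for i j
    using that B adj_index[of i B j] by (simp add: hermitian_def)
  have "col (A * W) 0 = e \<cdot>\<^sub>v col W 0"
    using A Wc v W(2) by (simp add: mult_mat_vec smult_smult_assoc mult.commute)
  then have B0: "B $$ (i,0) = (if i = 0 then e else 0)" if "i < ?m" for i
  proof -
    have "B $$ (i,0) = row (adj W) i \<bullet> col (A * W) 0"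
      using that A Wc by (simp add: B_def mult_assoc_dim)
    also have "\<dots> = e * (row (adj W) i \<bullet> col W 0)"
      using \<open>col (A * W) 0 = e \<cdot>\<^sub>v col W 0\<close> Wc that by simp
    also have "row (adj W) i \<bullet> col W 0 = (adj W * W) $$ (i,0)"
      using Wc that by simp
    finally show ?thesis using that WW by simp
  qed
  \<comment> \<open>\<open>e\<close> is a diagonal entry of the hermitian \<open>B\<close>, hence
    equal to its conjugate.\<close>
  have e_real: "e = complex_of_real (Re e)"
    using Bsym[of 0 0] B0[of 0] by (simp add: complex_eq_iff)
  define C where "C = mat n n (\<lambda>(i,j). B $$ (Suc i, Suc j))"
  have "hermitian n C"
    unfolding hermitian_def
  proof
    show "adj C = C"
      by (rule eq_matI) (auto simp: C_def Bsym[symmetric])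
  qed (simp add: C_def)
  from Suc.IH[OF this] obtain V l where V: "unitary n V" "C = V * rdiag n l * adj V" by auto
  have Vc: "V \<in> carrier_mat n n" and VV: "adj V * V = 1\<^sub>m n" using V by (auto simp: unitary_def)
  let ?V = "four_block_mat (1\<^sub>m 1) (0\<^sub>m 1 n) (0\<^sub>m n 1) V"
  have Vb: "?V \<in> carrier_mat ?m ?m" using Vc by auto
  have adjVb: "adj ?V = four_block_mat (1\<^sub>m 1) (0\<^sub>m 1 n) (0\<^sub>m n 1) (adj V)"
    using Vc by (intro eq_matI) (auto simp: four_block_mat_def Let_def)
  have "adj ?V * ?V = four_block_mat (1\<^sub>m 1) (0\<^sub>m 1 n) (0\<^sub>m n 1) (1\<^sub>m n)"
    unfolding adjVb using Vc VV
    by (subst mult_four_block_mat[of _ 1 1 _ n _ n _ _ 1 _ n]) auto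
  also have "\<dots> = 1\<^sub>m ?m" by (intro eq_matI) (auto simp: four_block_mat_def Let_def)
  finally have uV0: "adj ?V * ?V = 1\<^sub>m ?m" .
  have uV: "unitary ?m ?V" by (rule unitaryI[OF Vb uV0])
  define l' where "l' i = (case i of 0 \<Rightarrow> Re e | Suc j \<Rightarrow> l j)" for i
  have ld: "rdiag ?m l' = four_block_mat (mat 1 1 (\<lambda>_. e)) (0\<^sub>m 1 n) (0\<^sub>m n 1) (rdiag n l)"
    using e_real by (intro eq_matI) (auto simp: four_block_mat_def Let_def l'_def split: nat.splits)
  have "B = four_block_mat (mat 1 1 (\<lambda>_. e)) (0\<^sub>m 1 n) (0\<^sub>m n 1) C"
  proof (rule eq_matI)
    fix i j assume "i < dim_row (four_block_mat (mat 1 1 (\<lambda>_. e)) (0\<^sub>m 1 n) (0\<^sub>m n 1) C)"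
      "j < dim_col (four_block_mat (mat 1 1 (\<lambda>_. e)) (0\<^sub>m 1 n) (0\<^sub>m n 1) C)"
    then have ij: "i < ?m" "j < ?m" by (auto simp: C_def)
    show "B $$ (i,j) = four_block_mat (mat 1 1 (\<lambda>_. e)) (0\<^sub>m 1 n) (0\<^sub>m n 1) C $$ (i,j)"
      using ij B0[of i] B0[of j] Bsym[of i j] 
      by (cases i; cases j) (auto simp: four_block_mat_def Let_def C_def)
  qed (use B in \<open>auto simp: C_def\<close>)
  also have "\<dots> = ?V * rdiag ?m l' * adj ?V"
    unfolding adjVb ld V(2) using Vc
    apply (subst mult_four_block_mat[of _ 1 1 _ n _ n _ _ 1 _ n], auto)
    apply (subst mult_four_block_mat[of _ 1 1 _ n _ n _ _ 1 _ n], auto)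
    done
  finally have BV: "B = ?V * rdiag ?m l' * adj ?V" .
  have "A = W * B * adj W"
    unfolding B_def using unitary_conj_cancel[OF W(1) A] by simp
  also have "\<dots> = (W * ?V) * rdiag ?m l' * adj (W * ?V)"
    unfolding BV adj_mult[OF Wc Vb] using Wc Vc
    by (simp add: mult_assoc_dim)
  finally show ?case using unitary_mult[OF W(1) uV] by blast
qed

section \<open>Weighted logarithmic sums\<close>

text \<open>A term with \<open>p i = 0\<close> is constantly zero; in the others the argument of the
  logarithm is positive for \<open>t > 0\<close>, even when \<open>q i = 0\<close>.\<close>

lemma weighted_log_sum_deriv:
  fixes w p q :: "'a \<Rightarrow> real"
  assumes "finite I" "\<And>i. i \<in> I \<Longrightarrow> p i \<ge> 0" "\<And>i. i \<in> I \<Longrightarrow> q i \<ge> 0" "t > 0"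
  shows "((\<lambda>t. \<Sum>i\<in>I. w i * p i * ln (q i + t * p i)) has_real_derivative
    (\<Sum>i\<in>I. w i * (p i)\<^sup>2 / (q i + t * p i))) (at t)"
proof (rule DERIV_sum)
  fix i assume i: "i \<in> I"
  show "((\<lambda>t. w i * p i * ln (q i + t * p i)) has_real_derivative
    w i * (p i)\<^sup>2 / (q i + t * p i)) (at t)"
  proof (cases "p i = 0")
    case False
    then have "p i > 0" using assms(2)[OF i] by simp
    then have "q i + t * p i > 0" using assms(3)[OF i] assms(4) by (simp add: add_nonneg_pos)
    then show ?thesis by (auto intro!: derivative_eq_intros simp: power2_eq_square)
  qed simp
qed

text \<open>Because the weights \<open>w i * p i\<close> add up to 1, \<open>ln t\<close> can be
  distributed over the sum, and \<open>q i / t + p i\<close> tends to \<open>p i\<close>. The value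
  of \<open>logz\<close> at 0 only meets the factor \<open>p i = 0\<close>.\<close>

lemma weighted_log_sum_at_top:
  fixes w p q :: "'a \<Rightarrow> real"
  assumes "finite I" "\<And>i. i \<in> I \<Longrightarrow> p i \<ge> 0" "\<And>i. i \<in> I \<Longrightarrow> q i \<ge> 0"
    "(\<Sum>i\<in>I. w i * p i) = 1"
  shows "((\<lambda>t. (\<Sum>i\<in>I. w i * p i * ln (q i + t * p i)) - ln t) \<longlongrightarrow>
    (\<Sum>i\<in>I. w i * p i * logz (p i))) at_top"
proof -
  have "((\<lambda>t. \<Sum>i\<in>I. w i * p i * (ln (q i + t * p i) - ln t)) \<longlongrightarrow>
    (\<Sum>i\<in>I. w i * p i * logz (p i))) at_top"
  proof (rule tendsto_sum)
    fix i assume i: "i \<in> I"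
    show "((\<lambda>t. w i * p i * (ln (q i + t * p i) - ln t)) \<longlongrightarrow> w i * p i * logz (p i)) at_top"
    proof (cases "p i = 0")
      case False
      then have pos: "p i > 0" using assms(2)[OF i] by simp
      have "((\<lambda>t. q i * inverse t) \<longlongrightarrow> q i * 0) at_top"
        by (intro tendsto_intros tendsto_inverse_0_at_top filterlim_ident)
      then have "((\<lambda>t. ln (q i * inverse t + p i)) \<longlongrightarrow> ln (q i * 0 + p i)) at_top"
        using pos by (intro tendsto_ln tendsto_add tendsto_const) auto
      moreover have "eventually (\<lambda>t. ln (q i * inverse t + p i) = ln (q i + t * p i) - ln t) at_top"
        using eventually_gt_at_top[of 0]
      proof eventually_elim
        case (elim t)
        have "q i * inverse t + p i = (q i + t * p i) / t" using elim by (simp add: field_simps)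
        moreover have "q i + t * p i > 0" using elim pos assms(3)[OF i] by (simp add: add_nonneg_pos)
        ultimately show ?case using elim by (simp add: ln_div)
      qed
      ultimately have "((\<lambda>t. ln (q i + t * p i) - ln t) \<longlongrightarrow> ln (p i)) at_top"
        using tendsto_cong by fastforce
      then show ?thesis using pos by (auto simp: logz_def intro!: tendsto_intros)
    qed simp
  qed
  moreover have "(\<Sum>i\<in>I. w i * p i * (ln (q i + t * p i) - ln t)) =
      (\<Sum>i\<in>I. w i * p i * ln (q i + t * p i)) - ln t" for t
    using assms(4) by (simp add: right_diff_distrib sum_subtractf flip: sum_distrib_right)
  ultimately show ?thesis by simp
qed

text \<open>Terms with \<open>q i = 0\<close> vanish by the support hypothesis, so no logarithm
  diverges as \<open>t\<close> tends to 0.\<close>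

lemma weighted_log_sum_at_0:
  fixes w p q :: "'a \<Rightarrow> real"
  assumes "\<And>i. i \<in> I \<Longrightarrow> q i \<ge> 0" "\<And>i. i \<in> I \<Longrightarrow> q i = 0 \<Longrightarrow> w i * p i = 0"
  shows "((\<lambda>t. \<Sum>i\<in>I. w i * p i * ln (q i + t * p i)) \<longlongrightarrow>
    (\<Sum>i\<in>I. w i * p i * logz (q i))) (at_right 0)"
proof (rule tendsto_sum)
  fix i assume i: "i \<in> I"
  show "((\<lambda>t. w i * p i * ln (q i + t * p i)) \<longlongrightarrow> w i * p i * logz (q i)) (at_right 0)"
  proof (cases "q i = 0")
    case True
    then have "w i * p i = 0" using assms(2)[OF i] by simp
    then show ?thesis by (simp only: mult_zero_left tendsto_const)
  next
    case False
    then have pos: "q i > 0" using assms(1)[OF i] by simp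
    have "((\<lambda>t. w i * p i * ln (q i + t * p i)) \<longlongrightarrow> w i * p i * ln (q i + 0 * p i)) (at_right 0)"
      using pos by (intro tendsto_intros) auto
    then show ?thesis using pos by (simp add: logz_def)
  qed
qed

text \<open>The difference of the two logarithmic sums is nondecreasing in \<open>t\<close>. Its
  limit at infinity, where the two \<open>ln t\<close> cancel, is the difference of the
  \<open>p log p\<close> parts; its limit at 0 is that of the \<open>p log q\<close> parts.
  Comparing the limits gives the claim.\<close>

lemma relative_entropy_sum_mono:
  fixes w p q :: "'a \<Rightarrow> real" and w' p' q' :: "'b \<Rightarrow> real"
  assumes I: "finite I" "\<And>i. i \<in> I \<Longrightarrow> p i \<ge> 0" "\<And>i. i \<in> I \<Longrightarrow> q i \<ge> 0"
    "(\<Sum>i\<in>I. w i * p i) = 1" "\<And>i. i \<in> I \<Longrightarrow> q i = 0 \<Longrightarrow> w i * p i = 0"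
  and J: "finite J" "\<And>i. i \<in> J \<Longrightarrow> p' i \<ge> 0" "\<And>i. i \<in> J \<Longrightarrow> q' i \<ge> 0"
    "(\<Sum>i\<in>J. w' i * p' i) = 1" "\<And>i. i \<in> J \<Longrightarrow> q' i = 0 \<Longrightarrow> w' i * p' i = 0"
  and le: "\<And>t. t > 0 \<Longrightarrow> (\<Sum>i\<in>J. w' i * (p' i)\<^sup>2 / (q' i + t * p' i)) \<le>
      (\<Sum>i\<in>I. w i * (p i)\<^sup>2 / (q i + t * p i))"
  shows "(\<Sum>i\<in>J. w' i * p' i * (logz (p' i) - logz (q' i))) \<le>
      (\<Sum>i\<in>I. w i * p i * (logz (p i) - logz (q i)))"
proof -
  define f where "f t = (\<Sum>i\<in>I. w i * p i * ln (q i + t * p i))" for t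
  define g where "g t = (\<Sum>i\<in>J. w' i * p' i * ln (q' i + t * p' i))" for t
  let ?h = "\<lambda>t. f t - g t"
  have mono: "?h s \<le> ?h t" if "0 < s" "s \<le> t" for s t
  proof (rule DERIV_nonneg_imp_nondecreasing[OF that(2)])
    fix x assume "s \<le> x" "x \<le> t"
    then have x: "x > 0" using that by simp
    have "(f has_real_derivative (\<Sum>i\<in>I. w i * (p i)\<^sup>2 / (q i + x * p i))) (at x)"
      unfolding f_def by (rule weighted_log_sum_deriv) (use I x in auto)
    moreover have "(g has_real_derivative (\<Sum>i\<in>J. w' i * (p' i)\<^sup>2 / (q' i + x * p' i))) (at x)"
      unfolding g_def by (rule weighted_log_sum_deriv) (use J x in auto)
    ultimately have "(?h has_real_derivative (\<Sum>i\<in>I. w i * (p i)\<^sup>2 / (q i + x * p i)) -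
        (\<Sum>i\<in>J. w' i * (p' i)\<^sup>2 / (q' i + x * p' i))) (at x)"
      by (rule DERIV_diff)
    then show "\<exists>y. (?h has_real_derivative y) (at x) \<and> y \<ge> 0" using le[OF x] by (intro exI conjI) auto
  qed
  have "((\<lambda>t. f t - ln t) \<longlongrightarrow> (\<Sum>i\<in>I. w i * p i * logz (p i))) at_top"
    unfolding f_def by (rule weighted_log_sum_at_top) (use I in auto)
  moreover have "((\<lambda>t. g t - ln t) \<longlongrightarrow> (\<Sum>i\<in>J. w' i * p' i * logz (p' i))) at_top"
    unfolding g_def by (rule weighted_log_sum_at_top) (use J in auto)
  ultimately have "((\<lambda>t. (f t - ln t) - (g t - ln t)) \<longlongrightarrow>
      (\<Sum>i\<in>I. w i * p i * logz (p i)) - (\<Sum>i\<in>J. w' i * p' i * logz (p' i))) at_top"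
    by (rule tendsto_diff)
  then have top: "(?h \<longlongrightarrow> (\<Sum>i\<in>I. w i * p i * logz (p i)) - (\<Sum>i\<in>J. w' i * p' i * logz (p' i))) at_top"
    by simp
  have "(f \<longlongrightarrow> (\<Sum>i\<in>I. w i * p i * logz (q i))) (at_right 0)"
    unfolding f_def by (rule weighted_log_sum_at_0) (use I in auto)
  moreover have "(g \<longlongrightarrow> (\<Sum>i\<in>J. w' i * p' i * logz (q' i))) (at_right 0)"
    unfolding g_def by (rule weighted_log_sum_at_0) (use J in auto)
  ultimately have bot: "(?h \<longlongrightarrow> (\<Sum>i\<in>I. w i * p i * logz (q i)) - (\<Sum>i\<in>J. w' i * p' i * logz (q' i))) (at_right 0)"
    by (rule tendsto_diff)
  have "?h s \<le> (\<Sum>i\<in>I. w i * p i * logz (p i)) - (\<Sum>i\<in>J. w' i * p' i * logz (p' i))" if "s > 0" for s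
    using mono[OF that] by (intro tendsto_lowerbound[OF top])
      (auto simp: eventually_at_top_linorder)
  then have "(\<Sum>i\<in>I. w i * p i * logz (q i)) - (\<Sum>i\<in>J. w' i * p' i * logz (q' i)) \<le>
      (\<Sum>i\<in>I. w i * p i * logz (p i)) - (\<Sum>i\<in>J. w' i * p' i * logz (p' i))"
    by (intro tendsto_upperbound[OF bot]) (auto simp: eventually_at_filter)
  then show ?thesis by (simp add: right_diff_distrib sum_subtractf)
qed

text \<open>Otherwise the term at \<open>k\<close> would be \<open>w' k * p' k / t\<close>,
  unbounded for small \<open>t\<close>, while the right side stays below a constant. This is how the
  support condition of relative entropy passes to the image states.\<close>

lemma support_from_bound:
  fixes w p q :: "'a \<Rightarrow> real" and w' p' q' :: "'b \<Rightarrow> real"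
  assumes I: "\<And>i. i \<in> I \<Longrightarrow> p i \<ge> 0" "\<And>i. i \<in> I \<Longrightarrow> q i \<ge> 0"
    "\<And>i. i \<in> I \<Longrightarrow> w i \<ge> 0" "\<And>i. i \<in> I \<Longrightarrow> q i = 0 \<Longrightarrow> w i * p i = 0"
  and J: "finite J" "\<And>i. i \<in> J \<Longrightarrow> p' i \<ge> 0" "\<And>i. i \<in> J \<Longrightarrow> q' i \<ge> 0"
    "\<And>i. i \<in> J \<Longrightarrow> w' i \<ge> 0"
  and le: "\<And>t. t > 0 \<Longrightarrow> (\<Sum>i\<in>J. w' i * (p' i)\<^sup>2 / (q' i + t * p' i)) \<le>
      (\<Sum>i\<in>I. w i * (p i)\<^sup>2 / (q i + t * p i))"
  and k: "k \<in> J" "q' k = 0"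
  shows "w' k * p' k = 0"
proof (rule ccontr)
  assume "w' k * p' k \<noteq> 0"
  then have wp: "w' k * p' k > 0" "p' k > 0" using J(2,4)[OF k(1)] by (auto simp: less_le)
  \<comment> \<open>Where \<open>q i = 0\<close> the quotient is 0 by convention, which agrees with
    the terms for \<open>t > 0\<close> because \<open>w i * p i = 0\<close> there.\<close>
  define C where "C = (\<Sum>i\<in>I. w i * (p i)\<^sup>2 / q i)"
  have "C \<ge> 0" unfolding C_def using I by (intro sum_nonneg divide_nonneg_nonneg mult_nonneg_nonneg) auto
  \<comment> \<open>Chosen so that the term at \<open>k\<close> alone equals
    \<open>C + 1\<close>.\<close>
  define t where "t = w' k * p' k / (C + 1)"
  have t: "t > 0" using wp \<open>C \<ge> 0\<close> by (simp add: t_def)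
  have "w' k \<noteq> 0" using wp by auto
  then have "C + 1 = w' k * p' k / t" using wp \<open>C \<ge> 0\<close> by (simp add: t_def)
  also have "\<dots> = w' k * (p' k)\<^sup>2 / (q' k + t * p' k)"
    using wp t k by (simp add: power2_eq_square)
  also have "\<dots> \<le> (\<Sum>i\<in>J. w' i * (p' i)\<^sup>2 / (q' i + t * p' i))"
    using J k t by (intro member_le_sum) (auto intro!: divide_nonneg_nonneg add_nonneg_nonneg)
  also have "\<dots> \<le> (\<Sum>i\<in>I. w i * (p i)\<^sup>2 / (q i + t * p i))" by (rule le[OF t])
  also have "\<dots> \<le> C" unfolding C_def
  proof (rule sum_mono)
    fix i assume i: "i \<in> I"
    show "w i * (p i)\<^sup>2 / (q i + t * p i) \<le> w i * (p i)\<^sup>2 / q i"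
    proof (cases "q i = 0")
      case True
      then have "w i * (p i)\<^sup>2 = 0" using I(4)[OF i] by auto
      then show ?thesis by (simp only: div_0 order.refl)
    next
      case False
      then have "q i > 0" using I(2)[OF i] by simp
      moreover have "t * p i \<ge> 0" using I(1)[OF i] t by simp
      ultimately show ?thesis using I(3)[OF i]
        by (intro divide_left_mono mult_pos_pos mult_nonneg_nonneg) auto
    qed
  qed
  finally show False by simp
qed

section \<open>Relative entropy in terms of spectral decompositions\<close>

lemma psd_quad:
  assumes "psd D A" "C \<in> carrier_mat D m" "i < m"
  shows "Re ((adj C * A * C) $$ (i,i)) \<ge> 0"
proof -
  have A: "A \<in> carrier_mat D D" using assms by (auto simp: psd_def hermitian_def)
  have c: "col C i \<in> carrier_vec D" using assms by auto
  have "(adj C * A * C) $$ (i,i) = (adj C * (A * C)) $$ (i,i)"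
    using A assms by (simp add: mult_assoc_dim)
  also have "\<dots> = row (adj C) i \<bullet> col (A * C) i" using A assms by simp
  also have "row (adj C) i = conjugate (col C i)" using assms by (intro eq_vecI) auto
  also have "col (A * C) i = A *\<^sub>v col C i" using A assms by simp
  finally show ?thesis using assms(1) c by (auto simp: psd_def Let_def)
qed

lemma psd_tr_nonneg:
  assumes "psd D A" "C \<in> carrier_mat D m"
  shows "Re (tr (A * (C * adj C))) \<ge> 0"
proof -
  have A: "A \<in> carrier_mat D D" using assms by (auto simp: psd_def hermitian_def)
  have "tr (A * (C * adj C)) = tr ((A * C) * adj C)"
    using A assms by (simp add: mult_assoc_dim)
  also have "\<dots> = tr (adj C * (A * C))" using A assms by (intro tr_comm[of _ D m]) auto
  also have "\<dots> = tr (adj C * A * C)" using A assms by (simp add: mult_assoc_dim)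
  finally show ?thesis using psd_quad[OF assms] assms(2) by (auto simp: tr_def intro!: sum_nonneg)
qed

lemma tr_rdiag:
  assumes "A \<in> carrier_mat D D"
  shows "tr (rdiag D p * A) = (\<Sum>i<D. complex_of_real (p i) * A $$ (i,i))"
proof -
  have "(\<Sum>l<D. rdiag D p $$ (i,l) * A $$ (l,i)) = complex_of_real (p i) * A $$ (i,i)" if "i < D" for i
  proof -
    have "(\<Sum>l<D. rdiag D p $$ (i,l) * A $$ (l,i)) =
        (\<Sum>l<D. if l = i then complex_of_real (p i) * A $$ (i,i) else 0)"
      using that by (intro sum.cong) auto
    then show ?thesis using that by simp
  qed
  then show ?thesis using tr_mult[of "rdiag D p" D D A] assms by auto
qed

lemma unitaryD:
  assumes "unitary D U"
  shows "U \<in> carrier_mat D D" "dim_row U = D" "dim_col U = D" "U * adj U = 1\<^sub>m D" "adj U * U = 1\<^sub>m D"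
  using assms by (auto simp: unitary_def)

lemma unitary_cancel:
  assumes "unitary D U" "dim_row A = D"
  shows "U * (adj U * A) = A" "adj U * (U * A) = A"
proof -
  have A: "A \<in> carrier_mat D (dim_col A)" using assms by auto
  note u = unitaryD[OF assms(1)]
  have "U * (adj U * A) = (U * adj U) * A" using u(2,3) A by (simp add: mult_assoc_dim)
  then show "U * (adj U * A) = A" using u A by simp
  have "adj U * (U * A) = (adj U * U) * A" using u(2,3) A by (simp add: mult_assoc_dim)
  then show "adj U * (U * A) = A" using u A by simp
qed

lemma tr_spectral:
  assumes U: "unitary D U" and "Y \<in> carrier_mat D D"
  shows "tr (U * rdiag D p * adj U * Y) = (\<Sum>i<D. complex_of_real (p i) * (adj U * Y * U) $$ (i,i))"
proof -
  note u = unitaryD[OF U]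
  have "tr (U * rdiag D p * adj U * Y) = tr (U * (rdiag D p * adj U * Y))"
    using u(2,3) assms by (simp add: mult_assoc_dim)
  also have "\<dots> = tr (rdiag D p * adj U * Y * U)"
    using u(1) assms by (intro tr_comm[of _ D D]) auto
  also have "\<dots> = tr (rdiag D p * (adj U * Y * U))"
    using u(2,3) assms by (simp add: mult_assoc_dim)
  also have "\<dots> = (\<Sum>i<D. complex_of_real (p i) * (adj U * Y * U) $$ (i,i))"
    using u(1) assms by (intro tr_rdiag) auto
  finally show ?thesis .
qed

lemma psd_spectral_nonneg:
  assumes "psd D A" "unitary D U" "A = U * rdiag D l * adj U" "i < D"
  shows "l i \<ge> 0"
proof -
  note u = unitaryD[OF assms(2)]
  have "adj U * A * U = rdiag D l"
    unfolding assms(3) using u by (simp add: mult_assoc_dim unitary_cancel[OF assms(2)])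
  then show ?thesis using psd_quad[OF assms(1) u(1) assms(4)] assms(4) by simp
qed

lemma mult_adj_index:
  assumes "A \<in> carrier_mat n m" "B \<in> carrier_mat k m" "i < n" "j < k"
  shows "(A * adj B) $$ (i,j) = (\<Sum>l<m. A $$ (i,l) * cnj (B $$ (j,l)))"
  using assms by (subst mult_index_sum[of A n m "adj B" k]) auto

lemma adj_mult_index:
  assumes "A \<in> carrier_mat m n" "B \<in> carrier_mat m k" "i < n" "j < k"
  shows "(adj A * B) $$ (i,j) = (\<Sum>l<m. cnj (A $$ (l,i)) * B $$ (l,j))"
  using assms by (subst mult_index_sum[of "adj A" n m B k]) auto

text \<open>A converse to \<open>psd_tr_nonneg\<close>: a suitable test matrix recovers the
  quadratic form at \<open>v\<close>, whose value is real by hermiticity.\<close>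

lemma psdI:
  assumes A: "hermitian D A" and pos: "\<And>X. X \<in> carrier_mat D D \<Longrightarrow> Re (tr (A * (X * adj X))) \<ge> 0"
  shows "psd D A"
  unfolding psd_def Let_def
proof (intro conjI ballI A)
  fix v :: "complex vec" assume v: "v \<in> carrier_vec D"
  have Ac: "A \<in> carrier_mat D D" "adj A = A" using A by (auto simp: hermitian_def)
  have sym: "cnj (A $$ (i,k)) = A $$ (k,i)" if "i < D" "k < D" for i k
    using adj_index[of k A i] Ac that by simp
  have z: "conjugate v \<bullet> (A *\<^sub>v v) = (\<Sum>i<D. \<Sum>k<D. cnj (v $ i) * A $$ (i,k) * v $ k)"
    using Ac(1) v by (auto simp: scalar_prod_def atLeast0LessThan sum_distrib_left mult.assoc intro!: sum.cong)
  have "cnj (conjugate v \<bullet> (A *\<^sub>v v)) = (\<Sum>i<D. \<Sum>k<D. cnj (v $ k) * A $$ (k,i) * v $ i)"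
    unfolding z by (simp add: sym mult_ac)
  also have "\<dots> = conjugate v \<bullet> (A *\<^sub>v v)" unfolding z by (rule sum.swap)
  finally show "Im (conjugate v \<bullet> (A *\<^sub>v v)) = 0" by (simp add: complex_eq_iff)
  \<comment> \<open>Only column 0 is filled, with \<open>v\<close>, so \<open>X * adj X\<close> is
    the outer product of \<open>v\<close> with itself.\<close>
  define X where "X = mat D D (\<lambda>(i,j). if j = 0 then v $ i else 0)"
  have X: "X \<in> carrier_mat D D" by (simp add: X_def)
  have XX: "(X * adj X) $$ (k,i) = v $ k * cnj (v $ i)" if "k < D" "i < D" for i k
  proof -
    have "(X * adj X) $$ (k,i) = (\<Sum>l<D. X $$ (k,l) * cnj (X $$ (i,l)))"
      by (rule mult_adj_index[OF X X that])
    also have "\<dots> = (\<Sum>l<D. if l = 0 then v $ k * cnj (v $ i) else 0)"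
      using that by (intro sum.cong) (auto simp: X_def)
    finally show ?thesis using that by simp
  qed
  have "tr (A * (X * adj X)) = (\<Sum>i<D. \<Sum>k<D. A $$ (i,k) * (X * adj X) $$ (k,i))"
    using Ac X by (intro tr_mult) auto
  also have "\<dots> = conjugate v \<bullet> (A *\<^sub>v v)"
    unfolding z using XX by (simp add: mult_ac del: index_mult_mat(1))
  finally show "Re (conjugate v \<bullet> (A *\<^sub>v v)) \<ge> 0" using pos[OF X] by simp
qed

lemma rdiag_mult_index:
  assumes "A \<in> carrier_mat D m" "i < D" "j < m"
  shows "(rdiag D p * A) $$ (i,j) = complex_of_real (p i) * A $$ (i,j)"
proof -
  have "(rdiag D p * A) $$ (i,j) = (\<Sum>l<D. rdiag D p $$ (i,l) * A $$ (l,j))"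
    using assms by (intro mult_index_sum) auto
  also have "\<dots> = (\<Sum>l<D. if l = i then complex_of_real (p i) * A $$ (i,j) else 0)"
    using assms by (intro sum.cong) auto
  finally show ?thesis using assms by simp
qed

lemma mult_rdiag_index:
  assumes "A \<in> carrier_mat m D" "i < m" "j < D"
  shows "(A * rdiag D p) $$ (i,j) = A $$ (i,j) * complex_of_real (p j)"
proof -
  have "(A * rdiag D p) $$ (i,j) = (\<Sum>l<D. A $$ (i,l) * rdiag D p $$ (l,j))"
    using assms by (intro mult_index_sum) auto
  also have "\<dots> = (\<Sum>l<D. if l = j then A $$ (i,j) * complex_of_real (p j) else 0)"
    using assms by (intro sum.cong) auto
  finally show ?thesis using assms by simp
qed

text \<open>The choice inside \<open>matfun\<close> does not depend on the function, so a single
  decomposition serves the matrix and its logarithm at once.\<close>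

lemma matfun_spectral:
  assumes "hermitian D A"
  obtains U l where "unitary D U" "A = U * rdiag D l * adj U"
    "\<And>f. matfun D f A = U * rdiag D (f \<circ> l) * adj U"
proof -
  define c where "c = (SOME (U, l). unitary D U \<and> A = U * rdiag D l * adj U)"
  have "(case c of (U, l) \<Rightarrow> unitary D U \<and> A = U * rdiag D l * adj U)"
    unfolding c_def by (rule someI_ex) (use spectral_theorem_hermitian[OF assms] in auto)
  moreover obtain U l where c: "c = (U, l)" by (cases c)
  ultimately have "unitary D U" "A = U * rdiag D l * adj U" by simp_all
  moreover have "matfun D f A = U * rdiag D (f \<circ> l) * adj U" for f
    unfolding matfun_def c_def[symmetric] c by simp
  ultimately show thesis by (rule that)
qed

lemma unitary_adj: "unitary D U \<Longrightarrow> unitary D (adj U)"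
  by (auto simp: unitary_def)

lemma unitary_row_norm:
  assumes "unitary D M" "i < D"
  shows "(\<Sum>j<D. (cmod (M $$ (i,j)))\<^sup>2) = 1"
proof -
  note u = unitaryD[OF assms(1)]
  have "complex_of_real (\<Sum>j<D. (cmod (M $$ (i,j)))\<^sup>2) = (\<Sum>j<D. M $$ (i,j) * cnj (M $$ (i,j)))"
    by (simp add: complex_norm_square del: of_real_power)
  also have "\<dots> = (M * adj M) $$ (i,i)" using mult_adj_index[OF u(1) u(1) assms(2) assms(2)] by simp
  also have "\<dots> = complex_of_real 1" using u(4) assms(2) by simp
  finally show ?thesis by (simp only: of_real_eq_iff)
qed

text \<open>The sum over pairs of eigenvectors is the relative entropy of the two joint distributions
  \<open>p\<^sub>i |\<langle>u\<^sub>i|w\<^sub>j\<rangle>|\<^sup>2\<close> and \<open>q\<^sub>j |\<langle>u\<^sub>i|w\<^sub>j\<rangle>|\<^sup>2\<close> of Nussbaum and Szkola.\<close>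
lemma tr_log_diff_spectral:
  assumes U: "unitary D U" and W: "unitary D W"
  shows "Re (tr (U * rdiag D p * adj U * (U * rdiag D a * adj U - W * rdiag D b * adj W))) =
    (\<Sum>(i,j)\<in>{..<D}\<times>{..<D}. (cmod ((adj U * W) $$ (i,j)))\<^sup>2 * p i * (a i - b j))"
proof -
  note u = unitaryD[OF U] and w = unitaryD[OF W]
  define M where "M = adj U * W"
  have M: "M \<in> carrier_mat D D" using u w by (auto simp: M_def)
  have uM: "unitary D M" unfolding M_def by (intro unitary_mult unitary_adj U W)
  let ?Y = "U * rdiag D a * adj U - W * rdiag D b * adj W"
  have diag: "(adj U * ?Y * U) $$ (i,i) =
      complex_of_real (\<Sum>j<D. (cmod (M $$ (i,j)))\<^sup>2 * (a i - b j))" if i: "i < D" for i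
  proof -
    have "adj U * ?Y * U = adj U * (U * rdiag D a * adj U) * U - adj U * (W * rdiag D b * adj W) * U"
      using u(1) w(1)
      by (subst mult_minus_distrib_mat[of _ D D _ D], auto)
        (subst minus_mult_distrib_mat[of _ D D _ _ D], auto)
    also have "adj U * (U * rdiag D a * adj U) * U = rdiag D a"
      using u(2,3,4,5) by (simp add: mult_assoc_dim unitary_cancel[OF U])
    also have "adj U * (W * rdiag D b * adj W) * U = M * rdiag D b * adj M"
      using u(2,3) w(2,3) by (simp add: M_def mult_assoc_dim adj_mult_dim)
    finally have "(adj U * ?Y * U) $$ (i,i) = complex_of_real (a i) - (M * rdiag D b * adj M) $$ (i,i)"
      using i M by simp
    also have "(M * rdiag D b * adj M) $$ (i,i) = (\<Sum>j<D. (M * rdiag D b) $$ (i,j) * cnj (M $$ (i,j)))"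
      using M i by (intro mult_adj_index) auto
    also have "\<dots> = (\<Sum>j<D. complex_of_real ((cmod (M $$ (i,j)))\<^sup>2 * b j))"
      using M i by (intro sum.cong)
        (auto simp: mult_rdiag_index complex_norm_square simp del: of_real_power index_mult_mat(1))
    \<comment> \<open>Rows of a unitary have norm 1, so \<open>a i\<close> can be spread over
      \<open>j\<close> and both logarithms come under a common sum.\<close>
    also have "complex_of_real (a i) = complex_of_real (\<Sum>j<D. (cmod (M $$ (i,j)))\<^sup>2 * a i)"
      using unitary_row_norm[OF uM i] by (simp flip: sum_distrib_right)
    finally show ?thesis by (simp add: right_diff_distrib sum_subtractf)
  qed
  have "tr (U * rdiag D p * adj U * ?Y) = (\<Sum>i<D. complex_of_real (p i) * (adj U * ?Y * U) $$ (i,i))"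
    using w u by (intro tr_spectral[OF U]) auto
  also have "\<dots> = complex_of_real (\<Sum>i<D. \<Sum>j<D. (cmod (M $$ (i,j)))\<^sup>2 * p i * (a i - b j))"
    by (simp add: diag sum_distrib_left mult_ac del: index_mult_mat(1))
  finally show ?thesis by (simp add: M_def sum.cartesian_product)
qed

text \<open>The kernel of the second matrix is spanned by the columns of \<open>W\<close> with
  \<open>q j = 0\<close>, and the first matrix kills such a column exactly when \<open>p i\<close>
  times its overlap with column \<open>i\<close> of \<open>U\<close> vanishes for every
  \<open>i\<close>.\<close>

lemma kernel_inclusion_spectral:
  assumes U: "unitary D U" and W: "unitary D W"
  shows "(\<forall>v\<in>carrier_vec D. (W * rdiag D q * adj W) *\<^sub>v v = 0\<^sub>v D \<longrightarrow> (U * rdiag D p * adj U) *\<^sub>v v = 0\<^sub>v D)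
    \<longleftrightarrow> (\<forall>i<D. \<forall>j<D. q j = 0 \<longrightarrow> (cmod ((adj U * W) $$ (i,j)))\<^sup>2 * p i = 0)"
    (is "?L \<longleftrightarrow> ?R")
proof
  note u = unitaryD[OF U] and w = unitaryD[OF W]
  define M where "M = adj U * W"
  have M: "M \<in> carrier_mat D D" using u w by (auto simp: M_def)
  {
    assume L: ?L
    show ?R
    proof (intro allI impI)
      fix i j assume i: "i < D" and j: "j < D" and q: "q j = 0"
      have "(W * rdiag D q * adj W) *\<^sub>v col W j = col (W * rdiag D q * adj W * W) j"
        using w(1) j by (intro col_mult2[of _ D D _ D, symmetric]) auto
      also have "W * rdiag D q * adj W * W = W * rdiag D q"
        using w by (simp add: mult_assoc_dim)
      also have "col (W * rdiag D q) j = 0\<^sub>v D"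
        using w j q by (intro eq_vecI) (auto simp: mult_rdiag_index simp del: index_mult_mat(1))
      finally have "(U * rdiag D p * adj U) *\<^sub>v col W j = 0\<^sub>v D" using L w j by auto
      then have z: "col (U * rdiag D p * adj U * W) j = 0\<^sub>v D"
        using u(1) w(1) j by (subst col_mult2[of _ D D _ D]) auto
      have "complex_of_real (p i) * M $$ (i,j) = (rdiag D p * M) $$ (i,j)"
        using M i j by (simp add: rdiag_mult_index del: index_mult_mat(1))
      also have "rdiag D p * M = adj U * (U * rdiag D p * adj U * W)"
        using u(2,3) w(2,3) by (simp add: M_def mult_assoc_dim unitary_cancel[OF U])
      also have "\<dots> $$ (i,j) = row (adj U) i \<bullet> col (U * rdiag D p * adj U * W) j"
        using u w i j by simp
      also have "\<dots> = 0" unfolding z using u i by simp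
      finally show "(cmod ((adj U * W) $$ (i,j)))\<^sup>2 * p i = 0" unfolding M_def by auto
    qed
  next
    assume R: ?R
    show ?L
    proof (intro ballI impI)
      fix v :: "complex vec" assume v: "v \<in> carrier_vec D" and z: "(W * rdiag D q * adj W) *\<^sub>v v = 0\<^sub>v D"
      \<comment> \<open>The coordinates of \<open>v\<close> in the eigenbasis \<open>W\<close>;
        membership in the kernel confines them to the indices where \<open>q\<close>
        vanishes.\<close>
      define y where "y = adj W *\<^sub>v v"
      have y: "y \<in> carrier_vec D" using w(1) v unfolding y_def by (intro mult_mat_vec_carrier[of _ D D]) auto
      have "0\<^sub>v D = adj W *\<^sub>v ((W * rdiag D q * adj W) *\<^sub>v v)" unfolding z using w(2,3) by (intro eq_vecI) (auto simp: scalar_prod_def)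
      also have "\<dots> = (adj W * (W * rdiag D q * adj W)) *\<^sub>v v"
        using w v by (subst assoc_mult_mat_vec[of _ D D _ D]) auto
      also have "adj W * (W * rdiag D q * adj W) = rdiag D q * adj W"
        using w(2,3) by (simp add: mult_assoc_dim unitary_cancel[OF W])
      also have "\<dots> *\<^sub>v v = rdiag D q *\<^sub>v y"
        unfolding y_def using w v by (subst assoc_mult_mat_vec[of _ D D _ D]) auto
      finally have qy: "rdiag D q *\<^sub>v y = 0\<^sub>v D" ..
      have qy0: "q j = 0 \<or> y $ j = 0" if j: "j < D" for j
      proof -
        have "(rdiag D q *\<^sub>v y) $ j = (\<Sum>l<D. rdiag D q $$ (j,l) * y $ l)"
          using j y by (simp add: scalar_prod_def atLeast0LessThan)
        also have "\<dots> = (\<Sum>l<D. if l = j then complex_of_real (q j) * y $ j else 0)"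
          using j by (intro sum.cong) auto
        finally show ?thesis using qy j by auto
      qed
      have vy: "v = W *\<^sub>v y" unfolding y_def using w v
        by (subst assoc_mult_mat_vec[of _ D D _ D, symmetric]) auto
      have "(U * rdiag D p * adj U) *\<^sub>v v = U *\<^sub>v ((rdiag D p * M) *\<^sub>v y)"
      proof -
        have "(U * rdiag D p * adj U) *\<^sub>v v = (U * rdiag D p * adj U * W) *\<^sub>v y"
          unfolding vy using u w y by (subst assoc_mult_mat_vec[of _ D D _ D]) auto
        also have "U * rdiag D p * adj U * W = U * (rdiag D p * M)"
          using u(2,3) w(2,3) by (simp add: M_def mult_assoc_dim)
        also have "\<dots> *\<^sub>v y = U *\<^sub>v ((rdiag D p * M) *\<^sub>v y)"
          using u M y by (subst assoc_mult_mat_vec[of _ D D _ D]) auto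
        finally show ?thesis .
      qed
      also have "(rdiag D p * M) *\<^sub>v y = 0\<^sub>v D"
      proof (rule eq_vecI)
        fix i assume "i < dim_vec (0\<^sub>v D :: complex vec)"
        then have i: "i < D" by simp
        have "((rdiag D p * M) *\<^sub>v y) $ i = (\<Sum>l<D. (rdiag D p * M) $$ (i,l) * y $ l)"
          using i y M by (simp add: scalar_prod_def atLeast0LessThan del: index_mult_mat(1))
        also have "\<dots> = (\<Sum>l<D. complex_of_real (p i) * M $$ (i,l) * y $ l)"
          using i M by (simp add: rdiag_mult_index del: index_mult_mat(1))
        also have "\<dots> = 0"
          using R i qy0 by (intro sum.neutral) (auto simp: M_def simp del: index_mult_mat(1))
        finally show "((rdiag D p * M) *\<^sub>v y) $ i = 0\<^sub>v D $ i" using i by simp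
      qed (use M in auto)
      also have "U *\<^sub>v 0\<^sub>v D = 0\<^sub>v D" using u(2,3) by (intro eq_vecI) (auto simp: scalar_prod_def)
      finally show "(U * rdiag D p * adj U) *\<^sub>v v = 0\<^sub>v D" .
    qed
  }
qed

text \<open>The supremum over \<open>X\<close> is \<open>\<Sum>\<^sub>i\<^sub>j w\<^sub>i\<^sub>j p\<^sub>i\<^sup>2 / (q\<^sub>j + t p\<^sub>i)\<close>, the derivative in \<open>t\<close> of
  \<open>\<Sum>\<^sub>i\<^sub>j w\<^sub>i\<^sub>j p\<^sub>i ln (q\<^sub>j + t p\<^sub>i)\<close>, with \<open>w\<^sub>i\<^sub>j\<close> the squared overlaps of the eigenvectors
  (Kosaki's variational formula).\<close>
definition kosaki :: "real \<Rightarrow> complex mat \<Rightarrow> complex mat \<Rightarrow> complex mat \<Rightarrow> real" where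
  "kosaki t \<rho> \<sigma> X = 2 * Re (tr (\<rho> * X)) - t * Re (tr (\<rho> * (X * adj X))) - Re (tr (\<sigma> * (adj X * X)))"

text \<open>Express \<open>X\<close> in a mixed basis, with rows along \<open>U\<close> and columns
  along \<open>W\<close>. Then \<open>X * adj X\<close> is weighted by rows and
  \<open>adj X * X\<close> by columns, so the functional splits into independent problems for the
  single entries.\<close>

lemma kosaki_spectral:
  assumes U: "unitary D U" and W: "unitary D W" and X: "X \<in> carrier_mat D D"
  shows "kosaki t (U * rdiag D p * adj U) (W * rdiag D q * adj W) X =
    (\<Sum>(i,j)\<in>{..<D}\<times>{..<D}. 2 * p i * Re ((adj U * X * W) $$ (i,j) * cnj ((adj U * W) $$ (i,j)))
       - (q j + t * p i) * (cmod ((adj U * X * W) $$ (i,j)))\<^sup>2)"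
proof -
  note u = unitaryD[OF U] and w = unitaryD[OF W]
  define M where "M = adj U * W"
  define x where "x = adj U * X * W"
  have M: "M \<in> carrier_mat D D" using u w by (auto simp: M_def)
  have x: "x \<in> carrier_mat D D" using u w X by (auto simp: x_def)
  have Xd: "dim_row X = D" "dim_col X = D" using X by auto
  have 1: "Re (tr (U * rdiag D p * adj U * X)) = (\<Sum>i<D. \<Sum>j<D. p i * Re (x $$ (i,j) * cnj (M $$ (i,j))))"
  proof -
    have "adj U * X * U = x * adj M"
      using u(2,3) w(2,3) Xd by (simp add: x_def M_def adj_mult_dim mult_assoc_dim unitary_cancel[OF W])
    then have "tr (U * rdiag D p * adj U * X) = (\<Sum>i<D. complex_of_real (p i) * (x * adj M) $$ (i,i))"
      using tr_spectral[OF U X] by simp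
    also have "\<dots> = (\<Sum>i<D. complex_of_real (p i) * (\<Sum>j<D. x $$ (i,j) * cnj (M $$ (i,j))))"
      using x M by (simp add: mult_adj_index del: index_mult_mat(1))
    moreover have "Re (complex_of_real a * z) = a * Re z" for a z by simp
    ultimately show ?thesis by (simp add: sum_distrib_left del: times_complex.sel)
  qed
  have 2: "Re (tr (U * rdiag D p * adj U * (X * adj X))) = (\<Sum>i<D. \<Sum>j<D. p i * (cmod (x $$ (i,j)))\<^sup>2)"
  proof -
    have "adj U * (X * adj X) * U = x * adj x"
      using u(2,3) w(2,3) Xd by (simp add: x_def adj_mult_dim mult_assoc_dim unitary_cancel[OF W])
    then have "tr (U * rdiag D p * adj U * (X * adj X)) = (\<Sum>i<D. complex_of_real (p i) * (x * adj x) $$ (i,i))"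
      using tr_spectral[OF U, of "X * adj X"] X by simp
    also have "\<dots> = (\<Sum>i<D. complex_of_real (p i) * (\<Sum>j<D. x $$ (i,j) * cnj (x $$ (i,j))))"
      using x by (simp add: mult_adj_index del: index_mult_mat(1))
    also have "\<dots> = complex_of_real (\<Sum>i<D. \<Sum>j<D. p i * (cmod (x $$ (i,j)))\<^sup>2)"
      by (simp add: sum_distrib_left complex_norm_square del: of_real_power)
    finally show ?thesis by simp
  qed
  have 3: "Re (tr (W * rdiag D q * adj W * (adj X * X))) = (\<Sum>i<D. \<Sum>j<D. q j * (cmod (x $$ (i,j)))\<^sup>2)"
  proof -
    have "adj W * (adj X * X) * W = adj x * x"
      using u(2,3) w(2,3) Xd by (simp add: x_def adj_mult_dim mult_assoc_dim unitary_cancel[OF U])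
    then have "tr (W * rdiag D q * adj W * (adj X * X)) = (\<Sum>i<D. complex_of_real (q i) * (adj x * x) $$ (i,i))"
      using tr_spectral[OF W, of "adj X * X"] mult_carrier_mat[OF adj_carrier[OF X] X] by simp
    also have "\<dots> = (\<Sum>i<D. complex_of_real (q i) * (\<Sum>j<D. cnj (x $$ (j,i)) * x $$ (j,i)))"
      using x by (simp add: adj_mult_index del: index_mult_mat(1))
    also have "\<dots> = complex_of_real (\<Sum>i<D. \<Sum>j<D. q i * (cmod (x $$ (j,i)))\<^sup>2)"
      by (simp add: sum_distrib_left complex_norm_square mult.commute del: of_real_power)
    also have "(\<Sum>i<D. \<Sum>j<D. q i * (cmod (x $$ (j,i)))\<^sup>2) = (\<Sum>i<D. \<Sum>j<D. q j * (cmod (x $$ (i,j)))\<^sup>2)"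
      by (rule sum.swap)
    finally show ?thesis by simp
  qed
  show ?thesis
    unfolding kosaki_def 1 2 3 sum.cartesian_product[symmetric] M_def[symmetric] x_def[symmetric]
    by (simp add: sum_subtractf sum_distrib_left algebra_simps sum.distrib del: times_complex.sel)
qed

text \<open>Complete the square after bounding \<open>Re (x * cnj m)\<close> by the product of the
  moduli. If the denominator vanishes then \<open>p = 0\<close>, and both sides are 0.\<close>

lemma quadratic_completion_le:
  fixes x m :: complex
  assumes "p \<ge> 0" "q \<ge> 0" "t > 0"
  shows "2 * p * Re (x * cnj m) - (q + t * p) * (cmod x)\<^sup>2 \<le> (cmod m)\<^sup>2 * p\<^sup>2 / (q + t * p)"
proof (cases "q + t * p = 0")
  case True
  moreover have "t * p \<ge> 0" using assms by simp
  ultimately have "t * p = 0" using assms by linarith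
  then have "p = 0" using assms by simp
  then show ?thesis using True by simp
next
  case False
  define a where "a = q + t * p"
  have "t * p \<ge> 0" using assms by simp
  then have a: "a > 0" using False assms unfolding a_def by linarith
  have "Re (x * cnj m) \<le> cmod x * cmod m" using complex_Re_le_cmod[of "x * cnj m"] by (simp add: norm_mult del: times_complex.sel)
  then have "2 * p * Re (x * cnj m) \<le> 2 * p * (cmod x * cmod m)" using assms by (intro mult_left_mono) auto
  moreover have "2 * p * (cmod x * cmod m) - a * (cmod x)\<^sup>2 \<le> (cmod m)\<^sup>2 * p\<^sup>2 / a"
  proof -
    have "0 \<le> (p * cmod m - a * cmod x)\<^sup>2 / a" using a by simp
    also have "\<dots> = (cmod m)\<^sup>2 * p\<^sup>2 / a - (2 * p * (cmod x * cmod m) - a * (cmod x)\<^sup>2)"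
      using a by (simp add: field_simps power2_eq_square)
    finally show ?thesis by simp
  qed
  ultimately show ?thesis unfolding a_def by linarith
qed

text \<open>The maximiser is \<open>x = (p / a) m\<close>; for \<open>a = 0\<close> both sides
  vanish by the division convention.\<close>

lemma quadratic_completion_eq:
  fixes m :: complex and p a :: real
  shows "2 * p * Re (complex_of_real (p / a) * m * cnj m) -
      a * (cmod (complex_of_real (p / a) * m))\<^sup>2 = (cmod m)\<^sup>2 * p\<^sup>2 / a"
proof -
  have "complex_of_real (p / a) * m * cnj m = complex_of_real (p / a * (cmod m)\<^sup>2)"
    by (simp only: complex_norm_square mult.assoc of_real_mult)
  then have 1: "Re (complex_of_real (p / a) * m * cnj m) = p / a * (cmod m)\<^sup>2"
    by (metis Re_complex_of_real)
  have 2: "(cmod (complex_of_real (p / a) * m))\<^sup>2 = (p / a)\<^sup>2 * (cmod m)\<^sup>2"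
    by (simp only: norm_mult norm_of_real power_mult_distrib power2_abs)
  show ?thesis unfolding 1 2 by (cases "a = 0") (simp_all add: power2_eq_square field_simps)
qed

lemma kosaki_le:
  assumes "unitary D U" "unitary D W" "X \<in> carrier_mat D D" "t > 0"
    "\<And>i. i < D \<Longrightarrow> p i \<ge> 0" "\<And>i. i < D \<Longrightarrow> q i \<ge> 0"
  shows "kosaki t (U * rdiag D p * adj U) (W * rdiag D q * adj W) X \<le>
    (\<Sum>(i,j)\<in>{..<D}\<times>{..<D}. (cmod ((adj U * W) $$ (i,j)))\<^sup>2 * (p i)\<^sup>2 / (q j + t * p i))"
  unfolding kosaki_spectral[OF assms(1-3)]
  using quadratic_completion_le assms(4-6) by (intro sum_mono) (auto simp del: times_complex.sel)

lemma kosaki_attained: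
  assumes U: "unitary D U" and W: "unitary D W"
  obtains X where "X \<in> carrier_mat D D" "kosaki t (U * rdiag D p * adj U) (W * rdiag D q * adj W) X =
    (\<Sum>(i,j)\<in>{..<D}\<times>{..<D}. (cmod ((adj U * W) $$ (i,j)))\<^sup>2 * (p i)\<^sup>2 / (q j + t * p i))"
proof -
  note u = unitaryD[OF U] and w = unitaryD[OF W]
  define M where "M = adj U * W"
  \<comment> \<open>Take the maximiser of each entry, then rotate back from the mixed basis to
    obtain \<open>X\<close>.\<close>
  define x where "x = mat D D (\<lambda>(i,j). complex_of_real (p i / (q j + t * p i)) * M $$ (i,j))"
  have x: "x \<in> carrier_mat D D" by (auto simp: x_def)
  define X where "X = U * x * adj W"
  have X: "X \<in> carrier_mat D D" using u w x by (auto simp: X_def)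
  have Xx: "adj U * X * W = x"
    using u(2-5) w(2-5) x by (simp add: X_def mult_assoc_dim unitary_cancel[OF U])
  have "kosaki t (U * rdiag D p * adj U) (W * rdiag D q * adj W) X =
    (\<Sum>(i,j)\<in>{..<D}\<times>{..<D}. (cmod (M $$ (i,j)))\<^sup>2 * (p i)\<^sup>2 / (q j + t * p i))"
    unfolding kosaki_spectral[OF U W X] Xx M_def[symmetric]
  proof (intro sum.cong[OF refl], clarsimp simp del: times_complex.sel)
    fix i j assume "i < D" "j < D"
    then have "x $$ (i,j) = complex_of_real (p i / (q j + t * p i)) * M $$ (i,j)" by (simp add: x_def)
    then show "2 * p i * Re (x $$ (i,j) * cnj (M $$ (i,j))) - (q j + t * p i) * (cmod (x $$ (i,j)))\<^sup>2 =
      (cmod (M $$ (i,j)))\<^sup>2 * (p i)\<^sup>2 / (q j + t * p i)"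
      using quadratic_completion_eq[of "p i" "q j + t * p i" "M $$ (i,j)"] by (simp only:)
  qed
  then show thesis using X that unfolding M_def by blast
qed

section \<open>The data processing inequality\<close>

lemma trace_spectral:
  assumes "unitary D U"
  shows "tr (U * rdiag D p * adj U) = (\<Sum>i<D. complex_of_real (p i))"
proof -
  note u = unitaryD[OF assms]
  have "U * rdiag D p * adj U * 1\<^sub>m D = U * rdiag D p * adj U"
    using u(1) by (intro right_mult_one_mat[of _ D]) auto
  moreover have "adj U * 1\<^sub>m D * U = 1\<^sub>m D"
    using right_mult_one_mat[OF adj_carrier[OF u(1)]] u(5) by simp
  ultimately show ?thesis using tr_spectral[OF assms one_carrier_mat, of p] by simp
qed

text \<open>Domination of the functional for every test matrix gives domination of its maximum, the
  derivative sum in \<open>t\<close>. The scalar lemmas turn this first into the support condition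
  for the image pair and then into the inequality; an infinite right side is trivial.\<close>

theorem rel_ent_mono_of_kosaki:
  assumes \<rho>: "density D \<rho>" and \<sigma>: "psd D \<sigma>" and \<rho>': "density D' \<rho>'" and \<sigma>': "psd D' \<sigma>'"
    and dual: "\<And>t X. t > 0 \<Longrightarrow> X \<in> carrier_mat D' D' \<Longrightarrow>
      \<exists>Y\<in>carrier_mat D D. kosaki t \<rho>' \<sigma>' X \<le> kosaki t \<rho> \<sigma> Y"
  shows "rel_ent D' \<rho>' \<sigma>' \<le> rel_ent D \<rho> \<sigma>"
proof (cases "\<forall>v \<in> carrier_vec D. \<sigma> *\<^sub>v v = 0\<^sub>v D \<longrightarrow> \<rho> *\<^sub>v v = 0\<^sub>v D")
  case False
  then have "rel_ent D \<rho> \<sigma> = \<infinity>" unfolding rel_ent_def by (simp only: if_False)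
  then show ?thesis by simp
next
  case supp: True
  have p: "psd D \<rho>" "psd D' \<rho>'" using \<rho> \<rho>' by (auto simp: density_def)
  then have h: "hermitian D \<rho>" "hermitian D \<sigma>" "hermitian D' \<rho>'" "hermitian D' \<sigma>'"
    using \<sigma> \<sigma>' by (auto simp: psd_def)
  obtain U p where U: "unitary D U" and \<rho>_eq: "\<rho> = U * rdiag D p * adj U"
    and log\<rho>: "\<And>f. matfun D f \<rho> = U * rdiag D (f \<circ> p) * adj U" using matfun_spectral[OF h(1)] by metis
  obtain W q where W: "unitary D W" and \<sigma>_eq: "\<sigma> = W * rdiag D q * adj W"
    and log\<sigma>: "\<And>f. matfun D f \<sigma> = W * rdiag D (f \<circ> q) * adj W" using matfun_spectral[OF h(2)] by metis
  obtain U' p' where U': "unitary D' U'" and \<rho>'_eq: "\<rho>' = U' * rdiag D' p' * adj U'"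
    and log\<rho>': "\<And>f. matfun D' f \<rho>' = U' * rdiag D' (f \<circ> p') * adj U'" using matfun_spectral[OF h(3)] by metis
  obtain W' q' where W': "unitary D' W'" and \<sigma>'_eq: "\<sigma>' = W' * rdiag D' q' * adj W'"
    and log\<sigma>': "\<And>f. matfun D' f \<sigma>' = W' * rdiag D' (f \<circ> q') * adj W'" using matfun_spectral[OF h(4)] by metis
  have nn: "\<And>i. i < D \<Longrightarrow> p i \<ge> 0" "\<And>i. i < D \<Longrightarrow> q i \<ge> 0"
    and nn': "\<And>i. i < D' \<Longrightarrow> p' i \<ge> 0" "\<And>i. i < D' \<Longrightarrow> q' i \<ge> 0"
    using psd_spectral_nonneg p \<sigma> \<sigma>' U W U' W' \<rho>_eq \<sigma>_eq \<rho>'_eq \<sigma>'_eq by blast+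
  define w where "w i j = (cmod ((adj U * W) $$ (i,j)))\<^sup>2" for i j
  define w' where "w' i j = (cmod ((adj U' * W') $$ (i,j)))\<^sup>2" for i j
  have w_nonneg: "w i j \<ge> 0" "w' i j \<ge> 0" for i j by (simp_all add: w_def w'_def)
  \<comment> \<open>Evaluate at the maximiser \<open>X\<close> of the image pair; its partner
    \<open>Y\<close> bounds the maximum of the original pair from below, which is the direction
    required.\<close>
  have F_le: "(\<Sum>(i,j)\<in>{..<D'}\<times>{..<D'}. w' i j * (p' i)\<^sup>2 / (q' j + t * p' i)) \<le>
      (\<Sum>(i,j)\<in>{..<D}\<times>{..<D}. w i j * (p i)\<^sup>2 / (q j + t * p i))" if t: "t > 0" for t
  proof -
    obtain X where X: "X \<in> carrier_mat D' D'" "kosaki t \<rho>' \<sigma>' X =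
        (\<Sum>(i,j)\<in>{..<D'}\<times>{..<D'}. w' i j * (p' i)\<^sup>2 / (q' j + t * p' i))"
      using kosaki_attained[OF U' W'] unfolding w'_def \<rho>'_eq \<sigma>'_eq by blast
    obtain Y where Y: "Y \<in> carrier_mat D D" "kosaki t \<rho>' \<sigma>' X \<le> kosaki t \<rho> \<sigma> Y"
      using dual[OF t X(1)] by blast
    have "kosaki t \<rho> \<sigma> Y \<le> (\<Sum>(i,j)\<in>{..<D}\<times>{..<D}. w i j * (p i)\<^sup>2 / (q j + t * p i))"
      unfolding w_def \<rho>_eq \<sigma>_eq by (rule kosaki_le[OF U W Y(1) t nn])
    then show ?thesis using X Y by linarith
  qed
  have supp_w: "w i j * p i = 0" if "i < D" "j < D" "q j = 0" for i j
    using supp that unfolding \<rho>_eq \<sigma>_eq kernel_inclusion_spectral[OF U W] w_def by blast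
  have supp_w': "w' i j * p' i = 0" if "i < D'" "j < D'" "q' j = 0" for i j
  proof -
    have "(\<lambda>(i,j). w' i j) (i,j) * (\<lambda>(i,j). p' i) (i,j) = 0"
      by (rule support_from_bound[where I = "{..<D}\<times>{..<D}" and J = "{..<D'}\<times>{..<D'}"
        and p = "\<lambda>(i,j). p i" and q = "\<lambda>(i,j). q j" and w = "\<lambda>(i,j). w i j" and q' = "\<lambda>(i,j). q' j"])
        (use that nn nn' w_nonneg supp_w F_le in \<open>auto simp: case_prod_beta simp del: mult_eq_0_iff\<close>)
    then show ?thesis by simp
  qed
  \<comment> \<open>The squared overlaps sum to 1 over \<open>j\<close>, so the joint weights have
    the trace as total mass. Stated generically to cover both pairs.\<close>
  have tot: "(\<Sum>(i,j)\<in>{..<D}\<times>{..<D}. w i j * p i) = 1" 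
    if "unitary D U" "unitary D W" "tr (U * rdiag D p * adj U) = 1" "\<And>i j. w i j = (cmod ((adj U * W) $$ (i,j)))\<^sup>2"
    for D U W p and w :: "nat \<Rightarrow> nat \<Rightarrow> real"
  proof -
    have "(\<Sum>j<D. w i j) = 1" if "i < D" for i
      unfolding \<open>\<And>i j. w i j = _\<close> by (intro unitary_row_norm unitary_mult unitary_adj \<open>unitary D U\<close> \<open>unitary D W\<close> that)
    then have "(\<Sum>(i,j)\<in>{..<D}\<times>{..<D}. w i j * p i) = (\<Sum>i<D. p i)"
      by (simp add: sum.cartesian_product[symmetric] flip: sum_distrib_right)
    moreover have "complex_of_real (\<Sum>i<D. p i) = complex_of_real 1"
      using trace_spectral[OF \<open>unitary D U\<close>, of p] that(3) by simp
    ultimately show ?thesis by (simp only: of_real_eq_iff)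
  qed
  have t1: "(\<Sum>(i,j)\<in>{..<D}\<times>{..<D}. w i j * p i) = 1"
    using \<rho> \<rho>_eq by (intro tot[OF U W]) (auto simp: density_def w_def)
  have t1': "(\<Sum>(i,j)\<in>{..<D'}\<times>{..<D'}. w' i j * p' i) = 1"
    using \<rho>' \<rho>'_eq by (intro tot[OF U' W']) (auto simp: density_def w'_def)
  have "(\<Sum>x\<in>{..<D'}\<times>{..<D'}. (\<lambda>(i,j). w' i j) x * (\<lambda>(i,j). p' i) x * (logz ((\<lambda>(i,j). p' i) x) - logz ((\<lambda>(i,j). q' j) x))) \<le>
      (\<Sum>x\<in>{..<D}\<times>{..<D}. (\<lambda>(i,j). w i j) x * (\<lambda>(i,j). p i) x * (logz ((\<lambda>(i,j). p i) x) - logz ((\<lambda>(i,j). q j) x)))"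
    by (rule relative_entropy_sum_mono)
      (use nn nn' supp_w supp_w' F_le t1 t1' in \<open>auto simp: case_prod_beta simp del: mult_eq_0_iff\<close>)
  then have le: "(\<Sum>(i,j)\<in>{..<D'}\<times>{..<D'}. w' i j * p' i * (logz (p' i) - logz (q' j))) \<le>
      (\<Sum>(i,j)\<in>{..<D}\<times>{..<D}. w i j * p i * (logz (p i) - logz (q j)))"
    by (simp add: case_prod_beta)
  have supp': "\<forall>v\<in>carrier_vec D'. \<sigma>' *\<^sub>v v = 0\<^sub>v D' \<longrightarrow> \<rho>' *\<^sub>v v = 0\<^sub>v D'"
    unfolding \<rho>'_eq \<sigma>'_eq kernel_inclusion_spectral[OF U' W'] using supp_w' unfolding w'_def by blast
  have "Re (tr (\<rho>' * (matfun D' logz \<rho>' - matfun D' logz \<sigma>'))) \<le> Re (tr (\<rho> * (matfun D logz \<rho> - matfun D logz \<sigma>)))"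
    unfolding log\<rho> log\<sigma> log\<rho>' log\<sigma>' unfolding \<rho>_eq \<rho>'_eq
    unfolding tr_log_diff_spectral[OF U W] tr_log_diff_spectral[OF U' W']
    using le by (simp add: w_def w'_def)
  then show ?thesis unfolding rel_ent_def if_P[OF supp] if_P[OF supp'] by simp
qed

section \<open>Quantum channels in Kraus form\<close>

definition msum :: "nat \<Rightarrow> 'e set \<Rightarrow> ('e \<Rightarrow> complex mat) \<Rightarrow> complex mat" where
  "msum D E F = mat D D (\<lambda>(r,c). \<Sum>e\<in>E. F e $$ (r,c))"

lemma msum_carrier [simp, intro]: "msum D E F \<in> carrier_mat D D"
  and msum_dim [simp]: "dim_row (msum D E F) = D" "dim_col (msum D E F) = D"
  and msum_index [simp]: "i < D \<Longrightarrow> j < D \<Longrightarrow> msum D E F $$ (i,j) = (\<Sum>e\<in>E. F e $$ (i,j))"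
  by (auto simp: msum_def)

lemma adj_msum:
  assumes "\<And>e. e \<in> E \<Longrightarrow> F e \<in> carrier_mat D D"
  shows "adj (msum D E F) = msum D E (\<lambda>e. adj (F e))"
proof (rule eq_matI)
  fix i j assume ij: "i < dim_row (msum D E (\<lambda>e. adj (F e)))" "j < dim_col (msum D E (\<lambda>e. adj (F e)))"
  have "adj (F e) $$ (i,j) = cnj (F e $$ (j,i))" if "e \<in> E" for e
    using assms[OF that] ij by simp
  then show "adj (msum D E F) $$ (i,j) = msum D E (\<lambda>e. adj (F e)) $$ (i,j)"
    using ij by simp
qed auto

lemma tr_mult_msum:
  assumes A: "A \<in> carrier_mat D D" and F: "\<And>e. e \<in> E \<Longrightarrow> F e \<in> carrier_mat D D"
  shows "tr (A * msum D E F) = (\<Sum>e\<in>E. tr (A * F e))"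
proof -
  have "tr (A * msum D E F) = (\<Sum>i<D. \<Sum>l<D. \<Sum>e\<in>E. A $$ (i,l) * F e $$ (l,i))"
    using tr_mult[OF A msum_carrier] by (simp add: sum_distrib_left)
  also have "\<dots> = (\<Sum>i<D. \<Sum>e\<in>E. \<Sum>l<D. A $$ (i,l) * F e $$ (l,i))"
    by (intro sum.cong refl sum.swap)
  also have "\<dots> = (\<Sum>e\<in>E. \<Sum>i<D. \<Sum>l<D. A $$ (i,l) * F e $$ (l,i))"
    by (rule sum.swap)
  also have "\<dots> = (\<Sum>e\<in>E. tr (A * F e))"
    using tr_mult[OF A F] by (intro sum.cong) auto
  finally show ?thesis .
qed

text \<open>The completeness relation makes \<open>kraus_map\<close> trace preserving, or
  equivalently \<open>kraus_dual\<close> unital.\<close>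

definition kraus_family :: "nat \<Rightarrow> 'e set \<Rightarrow> ('e \<Rightarrow> complex mat) \<Rightarrow> bool" where
  "kraus_family D E K \<longleftrightarrow> (\<forall>e\<in>E. K e \<in> carrier_mat D D) \<and> msum D E (\<lambda>e. adj (K e) * K e) = 1\<^sub>m D"

definition kraus_map :: "nat \<Rightarrow> 'e set \<Rightarrow> ('e \<Rightarrow> complex mat) \<Rightarrow> complex mat \<Rightarrow> complex mat" where
  "kraus_map D E K \<rho> = msum D E (\<lambda>e. K e * \<rho> * adj (K e))"

definition kraus_dual :: "nat \<Rightarrow> 'e set \<Rightarrow> ('e \<Rightarrow> complex mat) \<Rightarrow> complex mat \<Rightarrow> complex mat" where
  "kraus_dual D E K X = msum D E (\<lambda>e. adj (K e) * X * K e)"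

lemma mult3_carrier: "A \<in> carrier_mat D D \<Longrightarrow> B \<in> carrier_mat D D \<Longrightarrow> C \<in> carrier_mat D D \<Longrightarrow> A * B * C \<in> carrier_mat D D"
  by (intro mult_carrier_mat[of _ D D])

context
  fixes D :: nat and E :: "'e set" and K :: "'e \<Rightarrow> complex mat"
  assumes K: "kraus_family D E K"
begin

lemma kraus_carrier: "e \<in> E \<Longrightarrow> K e \<in> carrier_mat D D"
  using K by (auto simp: kraus_family_def)

lemma kraus_dim: "e \<in> E \<Longrightarrow> dim_row (K e) = D" "e \<in> E \<Longrightarrow> dim_col (K e) = D"
  using kraus_carrier by auto

text \<open>Cyclicity of the trace in each Kraus term: \<open>kraus_dual\<close> is the Heisenberg
  picture of \<open>kraus_map\<close>.\<close>

lemma tr_kraus_map: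
  assumes \<rho>: "\<rho> \<in> carrier_mat D D" and X: "X \<in> carrier_mat D D"
  shows "tr (kraus_map D E K \<rho> * X) = tr (\<rho> * kraus_dual D E K X)"
proof -
  have "tr (kraus_map D E K \<rho> * X) = tr (X * kraus_map D E K \<rho>)"
    unfolding kraus_map_def using X by (intro tr_comm[of _ D D]) auto
  also have "\<dots> = (\<Sum>e\<in>E. tr (X * (K e * \<rho> * adj (K e))))"
    unfolding kraus_map_def using kraus_carrier \<rho> X by (intro tr_mult_msum mult3_carrier) auto
  also have "\<dots> = (\<Sum>e\<in>E. tr (\<rho> * (adj (K e) * X * K e)))"
  proof (rule sum.cong[OF refl])
    fix e assume e: "e \<in> E"
    note k = kraus_dim[OF e]
    have "X * (K e * \<rho> * adj (K e)) = (X * K e) * (\<rho> * adj (K e))"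
      using k \<rho> X by (simp add: mult_assoc_dim)
    also have "tr \<dots> = tr ((\<rho> * adj (K e)) * (X * K e))"
      using kraus_carrier[OF e] \<rho> X by (intro tr_comm[of _ D D] mult_carrier_mat[of _ D D]) auto
    finally show "tr (X * (K e * \<rho> * adj (K e))) = tr (\<rho> * (adj (K e) * X * K e))"
      using k \<rho> X by (simp add: mult_assoc_dim)
  qed
  also have "\<dots> = tr (\<rho> * kraus_dual D E K X)"
    unfolding kraus_dual_def using kraus_carrier \<rho> X by (intro tr_mult_msum[symmetric] mult3_carrier) auto
  finally show ?thesis .
qed

lemma adj_kraus_dual:
  assumes X: "X \<in> carrier_mat D D"
  shows "adj (kraus_dual D E K X) = kraus_dual D E K (adj X)"
proof -
  have "adj (adj (K e) * X * K e) = adj (K e) * adj X * K e" if "e \<in> E" for e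
    using kraus_dim[OF that] X by (simp add: adj_mult_dim mult_assoc_dim)
  then show ?thesis
    unfolding kraus_dual_def using kraus_carrier X
    by (subst adj_msum) (auto intro!: mult3_carrier simp: msum_def intro!: eq_matI sum.cong)
qed

text \<open>Kadison--Schwarz: with \<open>Y\<close> the image of \<open>X\<close> under the dual map, the defect is
  \<open>\<Sum>\<^sub>e C\<^sub>e C\<^sub>e\<^sup>*\<close> for \<open>C\<^sub>e = K\<^sub>e\<^sup>* X - Y K\<^sub>e\<^sup>*\<close>.\<close>
lemma kraus_schwarz:
  assumes \<rho>: "psd D \<rho>" and X: "X \<in> carrier_mat D D"
  shows "Re (tr (\<rho> * (kraus_dual D E K X * adj (kraus_dual D E K X)))) \<le>
    Re (tr (kraus_map D E K \<rho> * (X * adj X)))"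
proof -
  define Y where "Y = kraus_dual D E K X"
  have \<rho>c: "\<rho> \<in> carrier_mat D D" using \<rho> by (auto simp: psd_def hermitian_def)
  have Y: "Y \<in> carrier_mat D D" by (auto simp: Y_def kraus_dual_def)
  have adjY: "adj Y = msum D E (\<lambda>e. adj (K e) * adj X * K e)"
    unfolding Y_def adj_kraus_dual[OF X] by (simp add: kraus_dual_def)
  have one: "msum D E (\<lambda>e. adj (K e) * K e) = 1\<^sub>m D" using K by (simp add: kraus_family_def)
  define C where "C e = adj (K e) * X - Y * adj (K e)" for e
  have dims: "dim_row \<rho> = D" "dim_col \<rho> = D" "dim_row X = D" "dim_col X = D" "dim_row Y = D" "dim_col Y = D"
    using \<rho>c X Y by auto
  have expand: "tr (\<rho> * (C e * adj (C e))) = tr (\<rho> * (adj (K e) * (X * adj X) * K e))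
      - tr (adj Y * \<rho> * (adj (K e) * X * K e)) - tr (\<rho> * Y * (adj (K e) * adj X * K e))
      + tr (adj Y * \<rho> * Y * (adj (K e) * K e))" if e: "e \<in> E" for e
  proof -
    note k = kraus_carrier[OF e] and kd = kraus_dim[OF e]
    have c: "adj (K e) * X \<in> carrier_mat D D" "Y * adj (K e) \<in> carrier_mat D D"
      "adj X * K e \<in> carrier_mat D D" "K e * adj Y \<in> carrier_mat D D" "adj X * K e - K e * adj Y \<in> carrier_mat D D"
      using k X Y by (auto intro!: mult_carrier_mat[of _ D D] minus_carrier_mat)
    have a: "adj (C e) = adj X * K e - K e * adj Y"
      unfolding C_def using adj_minus[OF c(1,2)] kd dims by (simp add: adj_mult_dim)
    let ?P = "adj (K e) * X * (adj X * K e)" and ?Q = "adj (K e) * X * (K e * adj Y)"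
      and ?R = "Y * adj (K e) * (adj X * K e)" and ?T = "Y * adj (K e) * (K e * adj Y)"
    have pc: "?P \<in> carrier_mat D D" "?Q \<in> carrier_mat D D" "?R \<in> carrier_mat D D" "?T \<in> carrier_mat D D"
      using c by (auto intro!: mult_carrier_mat[of _ D D])
    have "C e * adj (C e) = (adj (K e) * X) * (adj X * K e - K e * adj Y) - (Y * adj (K e)) * (adj X * K e - K e * adj Y)"
      unfolding a unfolding C_def using c by (intro minus_mult_distrib_mat[of _ D D _ _ D]) auto
    also have "\<dots> = (?P - ?Q) - (?R - ?T)"
      unfolding mult_minus_distrib_mat[OF c(1,3,4)] mult_minus_distrib_mat[OF c(2,3,4)] ..
    finally have "\<rho> * (C e * adj (C e)) = \<rho> * (?P - ?Q) - \<rho> * (?R - ?T)"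
      using pc \<rho>c by (simp add: mult_minus_distrib_mat[of _ D D _ D] minus_carrier_mat)
    also have "\<dots> = (\<rho> * ?P - \<rho> * ?Q) - (\<rho> * ?R - \<rho> * ?T)"
      unfolding mult_minus_distrib_mat[OF \<rho>c pc(1,2)] mult_minus_distrib_mat[OF \<rho>c pc(3,4)] ..
    finally have "tr (\<rho> * (C e * adj (C e))) = (tr (\<rho> * ?P) - tr (\<rho> * ?Q)) - (tr (\<rho> * ?R) - tr (\<rho> * ?T))"
      using pc \<rho>c by (simp add: tr_minus[of _ D] minus_carrier_mat mult_carrier_mat[of _ D D])
    moreover have "?P = adj (K e) * (X * adj X) * K e" using kd dims by (simp add: mult_assoc_dim)
    moreover have "tr (\<rho> * ?Q) = tr (adj Y * \<rho> * (adj (K e) * X * K e))"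
    proof -
      have "tr (\<rho> * ?Q) = tr ((\<rho> * (adj (K e) * X * K e)) * adj Y)"
        using kd dims by (simp add: mult_assoc_dim)
      also have "\<dots> = tr (adj Y * (\<rho> * (adj (K e) * X * K e)))"
        using k Y X \<rho>c by (intro tr_comm[of _ D D] mult_carrier_mat[of _ D D]) auto
      finally show ?thesis using kd dims by (simp add: mult_assoc_dim)
    qed
    moreover have "\<rho> * ?R = \<rho> * Y * (adj (K e) * adj X * K e)" using kd dims by (simp add: mult_assoc_dim)
    moreover have "tr (\<rho> * ?T) = tr (adj Y * \<rho> * Y * (adj (K e) * K e))"
    proof -
      have "tr (\<rho> * ?T) = tr ((\<rho> * Y * (adj (K e) * K e)) * adj Y)"
        using kd dims by (simp add: mult_assoc_dim)
      also have "\<dots> = tr (adj Y * (\<rho> * Y * (adj (K e) * K e)))"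
        using k Y X \<rho>c by (intro tr_comm[of _ D D] mult_carrier_mat[of _ D D]) auto
      finally show ?thesis using kd dims by (simp add: mult_assoc_dim)
    qed
    ultimately show ?thesis by simp
  qed
  have "0 \<le> (\<Sum>e\<in>E. Re (tr (\<rho> * (C e * adj (C e)))))"
    using psd_tr_nonneg[OF \<rho>] kraus_carrier X Y
    by (intro sum_nonneg) (auto simp: C_def intro!: psd_tr_nonneg[OF \<rho>, of _ D] minus_carrier_mat mult_carrier_mat[of _ D D])
  also have "\<dots> = Re (\<Sum>e\<in>E. tr (\<rho> * (C e * adj (C e))))" by simp
  also have "(\<Sum>e\<in>E. tr (\<rho> * (C e * adj (C e)))) =
      (\<Sum>e\<in>E. tr (\<rho> * (adj (K e) * (X * adj X) * K e)))
      - (\<Sum>e\<in>E. tr (adj Y * \<rho> * (adj (K e) * X * K e))) - (\<Sum>e\<in>E. tr (\<rho> * Y * (adj (K e) * adj X * K e)))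
      + (\<Sum>e\<in>E. tr (adj Y * \<rho> * Y * (adj (K e) * K e)))"
    by (simp add: expand sum.distrib sum_subtractf)
  also have "(\<Sum>e\<in>E. tr (\<rho> * (adj (K e) * (X * adj X) * K e))) = tr (\<rho> * kraus_dual D E K (X * adj X))"
    unfolding kraus_dual_def using kraus_carrier \<rho>c X
    by (intro tr_mult_msum[symmetric] mult3_carrier mult_carrier_mat[of _ D D]) auto
  also have "\<dots> = tr (kraus_map D E K \<rho> * (X * adj X))"
    using tr_kraus_map[OF \<rho>c, of "X * adj X"] X by simp
  also have "(\<Sum>e\<in>E. tr (adj Y * \<rho> * (adj (K e) * X * K e))) = tr (adj Y * \<rho> * Y)"
    unfolding Y_def kraus_dual_def using kraus_carrier \<rho>c X
    by (intro tr_mult_msum[symmetric] mult3_carrier mult_carrier_mat[of _ D D]) auto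
  also have "(\<Sum>e\<in>E. tr (\<rho> * Y * (adj (K e) * adj X * K e))) = tr (\<rho> * Y * adj Y)"
    unfolding adjY using kraus_carrier \<rho>c X Y
    by (intro tr_mult_msum[symmetric] mult3_carrier mult_carrier_mat[of _ D D]) auto
  \<comment> \<open>Completeness makes the fourth sum equal to the second, so the two cancel and
    only minus the trace of \<open>\<rho> * Y * adj Y\<close> is left beside the first.\<close>
  also have "(\<Sum>e\<in>E. tr (adj Y * \<rho> * Y * (adj (K e) * K e))) = tr (adj Y * \<rho> * Y * msum D E (\<lambda>e. adj (K e) * K e))"
    using kraus_carrier \<rho>c X Y
    by (intro tr_mult_msum[symmetric] mult3_carrier mult_carrier_mat[of _ D D]) auto
  also have "adj Y * \<rho> * Y * msum D E (\<lambda>e. adj (K e) * K e) = adj Y * \<rho> * Y"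
    unfolding one using Y \<rho>c by (intro right_mult_one_mat[of _ D] mult3_carrier) auto
  also have "\<rho> * Y * adj Y = \<rho> * (Y * adj Y)" using dims by (simp add: mult_assoc_dim)
  finally show ?thesis by (simp add: Y_def)
qed

lemma kraus_map_hermitian:
  assumes "hermitian D \<rho>"
  shows "hermitian D (kraus_map D E K \<rho>)"
proof -
  have r: "\<rho> \<in> carrier_mat D D" "adj \<rho> = \<rho>" using assms by (auto simp: hermitian_def)
  have "adj (K e * \<rho> * adj (K e)) = K e * \<rho> * adj (K e)" if "e \<in> E" for e
    using kraus_dim[OF that] r by (simp add: adj_mult_dim mult_assoc_dim)
  then have "adj (kraus_map D E K \<rho>) = kraus_map D E K \<rho>"
    unfolding kraus_map_def using kraus_carrier r(1)
    by (subst adj_msum) (auto intro!: mult3_carrier simp: msum_def intro!: eq_matI sum.cong)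
  then show ?thesis by (auto simp: hermitian_def kraus_map_def)
qed

text \<open>By Kadison-Schwarz, testing the image against \<open>X * adj X\<close> gives at least
  the value of testing \<open>\<rho>\<close> against \<open>Y * adj Y\<close>, with \<open>Y\<close>
  the dual image of \<open>X\<close>, and that is nonnegative.\<close>

lemma kraus_map_psd:
  assumes \<rho>: "psd D \<rho>"
  shows "psd D (kraus_map D E K \<rho>)"
proof (rule psdI)
  have h: "hermitian D \<rho>" using \<rho> by (simp add: psd_def)
  then show "hermitian D (kraus_map D E K \<rho>)" by (rule kraus_map_hermitian)
  fix X :: "complex mat" assume X: "X \<in> carrier_mat D D"
  have "0 \<le> Re (tr (\<rho> * (kraus_dual D E K X * adj (kraus_dual D E K X))))"
    by (rule psd_tr_nonneg[OF \<rho>, of _ D]) (simp add: kraus_dual_def)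
  then show "0 \<le> Re (tr (kraus_map D E K \<rho> * (X * adj X)))"
    using kraus_schwarz[OF \<rho> X] by simp
qed

lemma kraus_map_density:
  assumes "density D \<rho>"
  shows "density D (kraus_map D E K \<rho>)"
proof -
  have p: "psd D \<rho>" and r: "\<rho> \<in> carrier_mat D D" and t: "tr \<rho> = 1"
    using assms by (auto simp: density_def psd_def hermitian_def)
  have "kraus_dual D E K (1\<^sub>m D) = 1\<^sub>m D"
  proof -
    have "adj (K e) * 1\<^sub>m D * K e = adj (K e) * K e" if "e \<in> E" for e
      using right_mult_one_mat[OF adj_carrier[OF kraus_carrier[OF that]]] by simp
    then have "kraus_dual D E K (1\<^sub>m D) = msum D E (\<lambda>e. adj (K e) * K e)"
      unfolding kraus_dual_def msum_def by (intro cong_mat) auto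
    then show ?thesis using K by (simp add: kraus_family_def)
  qed
  moreover have "kraus_map D E K \<rho> * 1\<^sub>m D = kraus_map D E K \<rho>"
    unfolding kraus_map_def by (rule right_mult_one_mat) auto
  ultimately have "tr (kraus_map D E K \<rho>) = tr \<rho>"
    using tr_kraus_map[OF r one_carrier_mat] right_mult_one_mat[OF r] by simp
  then show ?thesis using kraus_map_psd[OF p] t by (simp add: density_def)
qed

text \<open>Use the dual image of \<open>X\<close> as competitor. Duality preserves the linear term;
  Kadison-Schwarz, applied to \<open>X\<close> for \<open>\<rho>\<close> and to \<open>adj X\<close>
  for \<open>\<sigma>\<close>, controls the two quadratic terms.\<close>

theorem data_processing_inequality:
  assumes \<rho>: "density D \<rho>" and \<sigma>: "psd D \<sigma>"
  shows "rel_ent D (kraus_map D E K \<rho>) (kraus_map D E K \<sigma>) \<le> rel_ent D \<rho> \<sigma>"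
proof (rule rel_ent_mono_of_kosaki[OF \<rho> \<sigma> kraus_map_density[OF \<rho>] kraus_map_psd[OF \<sigma>]])
  fix t :: real and X :: "complex mat" assume t: "t > 0" and X: "X \<in> carrier_mat D D"
  let ?Y = "kraus_dual D E K X"
  have p: "psd D \<rho>" and r: "\<rho> \<in> carrier_mat D D"
    using \<rho> by (auto simp: density_def psd_def hermitian_def)
  have "Re (tr (kraus_map D E K \<rho> * X)) = Re (tr (\<rho> * ?Y))" using tr_kraus_map[OF r X] by simp
  moreover have "t * Re (tr (\<rho> * (?Y * adj ?Y))) \<le> t * Re (tr (kraus_map D E K \<rho> * (X * adj X)))"
    using kraus_schwarz[OF p X] t by simp
  moreover have "Re (tr (\<sigma> * (adj ?Y * ?Y))) \<le> Re (tr (kraus_map D E K \<sigma> * (adj X * X)))"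
    using kraus_schwarz[OF \<sigma> adj_carrier[OF X]] unfolding adj_kraus_dual[OF X, symmetric] by simp
  ultimately have "kosaki t (kraus_map D E K \<rho>) (kraus_map D E K \<sigma>) X \<le> kosaki t \<rho> \<sigma> ?Y"
    unfolding kosaki_def by linarith
  then show "\<exists>Y\<in>carrier_mat D D. kosaki t (kraus_map D E K \<rho>) (kraus_map D E K \<sigma>) X \<le> kosaki t \<rho> \<sigma> Y"
    by (intro bexI[of _ ?Y]) (auto simp: kraus_dual_def)
qed

end

text \<open>Row \<open>r\<close> of \<open>K e\<close> can be nonzero only in column
  \<open>f e r\<close>, so conjugation just reads \<open>\<rho>\<close> at relabelled indices. For
  the same reason the completeness relation has no off-diagonal part, and \<open>norm\<close> is its
  diagonal.\<close>

lemma monomial_kraus: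
  fixes f :: "'e \<Rightarrow> nat \<Rightarrow> nat" and a :: "'e \<Rightarrow> nat \<Rightarrow> complex"
  assumes f: "\<And>e r. e \<in> E \<Longrightarrow> r < D \<Longrightarrow> f e r < D"
    and norm: "\<And>x. x < D \<Longrightarrow> (\<Sum>e\<in>E. \<Sum>r<D. if f e r = x then a e r * cnj (a e r) else 0) = 1"
  defines "K \<equiv> \<lambda>e. mat D D (\<lambda>(r,x). if x = f e r then a e r else 0)"
  shows "kraus_family D E K"
    and "\<rho> \<in> carrier_mat D D \<Longrightarrow> kraus_map D E K \<rho> =
      mat D D (\<lambda>(r,c). \<Sum>e\<in>E. a e r * cnj (a e c) * \<rho> $$ (f e r, f e c))"
proof -
  have Kc: "K e \<in> carrier_mat D D" for e by (simp add: K_def)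
  have Ki: "K e $$ (r,x) = (if x = f e r then a e r else 0)" if "r < D" "x < D" for e r x
    using that by (simp add: K_def)
  have "msum D E (\<lambda>e. adj (K e) * K e) = 1\<^sub>m D"
  proof (rule eq_matI)
    fix x y assume "x < dim_row (1\<^sub>m D :: complex mat)" "y < dim_col (1\<^sub>m D :: complex mat)"
    then have xy: "x < D" "y < D" by auto
    have "msum D E (\<lambda>e. adj (K e) * K e) $$ (x,y) = (\<Sum>e\<in>E. \<Sum>r<D. cnj (K e $$ (r,x)) * K e $$ (r,y))"
      using xy by (simp add: adj_mult_index[OF Kc Kc] del: index_mult_mat(1))
    also have "\<dots> = (if x = y then (\<Sum>e\<in>E. \<Sum>r<D. if f e r = x then a e r * cnj (a e r) else 0) else 0)"
      using xy by (auto simp: Ki intro!: sum.cong sum.neutral)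
    finally show "msum D E (\<lambda>e. adj (K e) * K e) $$ (x,y) = 1\<^sub>m D $$ (x,y)" using xy norm by simp
  qed auto
  then show "kraus_family D E K" using Kc by (simp add: kraus_family_def)
  assume \<rho>: "\<rho> \<in> carrier_mat D D"
  have "(K e * \<rho> * adj (K e)) $$ (r,c) = a e r * cnj (a e c) * \<rho> $$ (f e r, f e c)"
    if e: "e \<in> E" and rc: "r < D" "c < D" for e r c
  proof -
    have *: "(K e * \<rho>) $$ (r,y) = a e r * \<rho> $$ (f e r, y)" if y: "y < D" for y
    proof -
      have "(K e * \<rho>) $$ (r,y) = (\<Sum>x<D. K e $$ (r,x) * \<rho> $$ (x,y))"
        by (rule mult_index_sum[OF Kc \<rho> rc(1) y])
      also have "\<dots> = (\<Sum>x<D. if x = f e r then a e r * \<rho> $$ (f e r, y) else 0)"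
        using rc by (intro sum.cong) (auto simp: Ki)
      finally show ?thesis using f[OF e rc(1)] by simp
    qed
    have "(K e * \<rho> * adj (K e)) $$ (r,c) = (\<Sum>y<D. (K e * \<rho>) $$ (r,y) * cnj (K e $$ (c,y)))"
      by (rule mult_adj_index[OF mult_carrier_mat[OF Kc \<rho>] Kc rc])
    also have "\<dots> = (\<Sum>y<D. if y = f e c then a e r * \<rho> $$ (f e r, f e c) * cnj (a e c) else 0)"
      using rc * by (intro sum.cong) (auto simp: Ki simp del: index_mult_mat(1))
    finally show ?thesis using f[OF e rc(2)] by simp
  qed
  then show "kraus_map D E K \<rho> = mat D D (\<lambda>(r,c). \<Sum>e\<in>E. a e r * cnj (a e c) * \<rho> $$ (f e r, f e c))"
    unfolding kraus_map_def msum_def by (intro cong_mat) (auto simp del: index_mult_mat(1))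
qed

text \<open>With \<open>(\<alpha>, \<beta>)\<close> the inverse of the basis permutation performed by the key unitary, this is
  \<open>A \<boxtimes> B\<close>; unlike the original definition it is visibly symmetric in the two inputs.\<close>
definition couple :: "nat \<Rightarrow> (nat \<Rightarrow> nat \<Rightarrow> nat) \<Rightarrow> (nat \<Rightarrow> nat \<Rightarrow> nat) \<Rightarrow> complex mat \<Rightarrow> complex mat \<Rightarrow> complex mat" where
  "couple D \<alpha> \<beta> A B = mat D D (\<lambda>(r,c). \<Sum>t<D. A $$ (\<alpha> r t, \<alpha> c t) * B $$ (\<beta> r t, \<beta> c t))"

lemma couple_commute: "couple D \<alpha> \<beta> A B = couple D \<beta> \<alpha> B A"
  by (simp add: couple_def mult.commute)

text \<open>Fixing the second input gives a channel: split \<open>\<tau>\<close> into rank-one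
  pieces indexed by \<open>m\<close> and the partial trace into its terms \<open>t\<close>, with one
  Kraus operator per pair \<open>(t, m)\<close>.\<close>

lemma couple_kraus:
  assumes \<tau>: "density D \<tau>"
    and bij: "bij_betw (\<lambda>(r,t). (\<alpha> r t, \<beta> r t)) ({..<D} \<times> {..<D}) ({..<D} \<times> {..<D})"
  shows "\<exists>K. kraus_family D ({..<D} \<times> {..<D}) K \<and>
    (\<forall>\<rho>\<in>carrier_mat D D. couple D \<alpha> \<beta> \<rho> \<tau> = kraus_map D ({..<D} \<times> {..<D}) K \<rho>)"
proof -
  have p: "psd D \<tau>" and h: "hermitian D \<tau>" and tr1: "tr \<tau> = 1" using \<tau> by (auto simp: density_def psd_def)
  have \<tau>c: "\<tau> \<in> carrier_mat D D" using h by (simp add: hermitian_def)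
  obtain W q where W: "unitary D W" and \<tau>_eq: "\<tau> = W * rdiag D q * adj W"
    using spectral_theorem_hermitian[OF h] by blast
  note w = unitaryD[OF W]
  have q: "q m \<ge> 0" if "m < D" for m by (rule psd_spectral_nonneg[OF p W \<tau>_eq that])
  \<comment> \<open>Eigenvectors scaled by the root of their eigenvalue, so that
    \<open>\<tau>\<close> is the sum of their outer products.\<close>
  define b where "b m x = complex_of_real (sqrt (q m)) * W $$ (x,m)" for m x
  have \<tau>b: "(\<Sum>m<D. b m x * cnj (b m y)) = \<tau> $$ (x,y)" if "x < D" "y < D" for x y
  proof -
    have "\<tau> $$ (x,y) = (\<Sum>m<D. (W * rdiag D q) $$ (x,m) * cnj (W $$ (y,m)))"
      unfolding \<tau>_eq using w(1) that by (intro mult_adj_index) auto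
    also have "\<dots> = (\<Sum>m<D. b m x * cnj (b m y))"
    proof (rule sum.cong[OF refl])
      fix m assume "m \<in> {..<D}"
      then have m: "m < D" by simp
      have "complex_of_real (sqrt (q m)) * complex_of_real (sqrt (q m)) = complex_of_real (q m)"
        using q[OF m] by (simp flip: of_real_mult)
      then show "(W * rdiag D q) $$ (x,m) * cnj (W $$ (y,m)) = b m x * cnj (b m y)"
        unfolding mult_rdiag_index[OF w(1) that(1) m] b_def by (simp add: algebra_simps)
    qed
    finally show ?thesis by simp
  qed
  have ab: "\<alpha> r t < D" "\<beta> r t < D" if "r < D" "t < D" for r t
    using bij_betwE[OF bij] that by auto
  define f where "f = (\<lambda>(t,m::nat) r. \<alpha> r t)"
  define a where "a = (\<lambda>(t,m) r. b m (\<beta> r t))"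
  let ?E = "{..<D} \<times> {..<D}"
  define K where "K e = mat D D (\<lambda>(r,x). if x = f e r then a e r else 0)" for e
  have f: "f e r < D" if "e \<in> ?E" "r < D" for e r using that ab by (auto simp: f_def)
  have norm: "(\<Sum>e\<in>?E. \<Sum>r<D. if f e r = x then a e r * cnj (a e r) else 0) = 1" if x: "x < D" for x
  proof -
    have "(\<Sum>e\<in>?E. \<Sum>r<D. if f e r = x then a e r * cnj (a e r) else 0) =
        (\<Sum>t<D. \<Sum>m<D. \<Sum>r<D. if \<alpha> r t = x then b m (\<beta> r t) * cnj (b m (\<beta> r t)) else 0)"
      by (simp add: sum.cartesian_product' f_def a_def cong: if_cong)
    also have "\<dots> = (\<Sum>t<D. \<Sum>r<D. \<Sum>m<D. if \<alpha> r t = x then b m (\<beta> r t) * cnj (b m (\<beta> r t)) else 0)"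
      by (intro sum.cong refl sum.swap)
    also have "\<dots> = (\<Sum>r<D. \<Sum>t<D. \<Sum>m<D. if \<alpha> r t = x then b m (\<beta> r t) * cnj (b m (\<beta> r t)) else 0)"
      by (rule sum.swap)
    also have "\<dots> = (\<Sum>r<D. \<Sum>t<D. if \<alpha> r t = x then \<tau> $$ (\<beta> r t, \<beta> r t) else 0)"
      using ab \<tau>b by (intro sum.cong) auto
    \<comment> \<open>As \<open>(r, t)\<close> runs over all pairs, so does
      \<open>(\<alpha> r t, \<beta> r t)\<close>. Fixing the first component to \<open>x\<close>
      leaves the whole diagonal of \<open>\<tau>\<close>, hence its trace.\<close>
    also have "\<dots> = (\<Sum>z\<in>?E. (\<lambda>(u,v). if u = x then \<tau> $$ (v,v) else 0) ((\<lambda>(r,t). (\<alpha> r t, \<beta> r t)) z))"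
      by (simp add: sum.cartesian_product case_prod_beta)
    also have "\<dots> = (\<Sum>z\<in>?E. (\<lambda>(u,v). if u = x then \<tau> $$ (v,v) else 0) z)"
      by (rule sum.reindex_bij_betw[OF bij])
    also have "\<dots> = (\<Sum>u<D. \<Sum>v<D. if u = x then \<tau> $$ (v,v) else 0)"
      by (simp add: sum.cartesian_product)
    also have "\<dots> = (\<Sum>u<D. if u = x then (\<Sum>v<D. \<tau> $$ (v,v)) else 0)"
      by (intro sum.cong) auto
    also have "\<dots> = tr \<tau>" using x \<tau>c by (simp add: tr_def)
    finally show ?thesis using tr1 by simp
  qed
  have "couple D \<alpha> \<beta> \<rho> \<tau> = kraus_map D ?E K \<rho>" if \<rho>: "\<rho> \<in> carrier_mat D D" for \<rho>
  proof -
    have "kraus_map D ?E K \<rho> = mat D D (\<lambda>(r,c). \<Sum>e\<in>?E. a e r * cnj (a e c) * \<rho> $$ (f e r, f e c))"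
      unfolding K_def using f norm \<rho> by (intro monomial_kraus(2)) auto
    also have "\<dots> = couple D \<alpha> \<beta> \<rho> \<tau>"
      unfolding couple_def
    proof (rule cong_mat, simp, simp, clarsimp)
      fix r c assume rc: "r < D" "c < D"
      have "(\<Sum>e\<in>?E. a e r * cnj (a e c) * \<rho> $$ (f e r, f e c)) =
          (\<Sum>t<D. \<Sum>m<D. b m (\<beta> r t) * cnj (b m (\<beta> c t)) * \<rho> $$ (\<alpha> r t, \<alpha> c t))"
        by (simp add: sum.cartesian_product f_def a_def case_prod_beta)
      also have "\<dots> = (\<Sum>t<D. \<rho> $$ (\<alpha> r t, \<alpha> c t) * \<tau> $$ (\<beta> r t, \<beta> c t))"
        using rc ab \<tau>b by (intro sum.cong) (auto simp flip: sum_distrib_right)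
      finally show "(\<Sum>e\<in>?E. a e r * cnj (a e c) * \<rho> $$ (f e r, f e c)) =
          (\<Sum>t<D. \<rho> $$ (\<alpha> r t, \<alpha> c t) * \<tau> $$ (\<beta> r t, \<beta> c t))" .
    qed
    finally show ?thesis ..
  qed
  moreover have "kraus_family D ?E K"
    unfolding K_def using f norm by (intro monomial_kraus(1)) auto
  ultimately show ?thesis by blast
qed

section \<open>Digits of basis indices\<close>

lemma digit_less: "d > 0 \<Longrightarrow> digit d i k < d"
  by (simp add: digit_def)

lemma enc_less:
  assumes "\<And>k. k < n \<Longrightarrow> a k < d"
  shows "enc d n a < d ^ n"
  using assms
proof (induction n)
  case (Suc n)
  have "a n < d" "enc d n a < d ^ n" using Suc by auto
  then have "enc d n a + a n * d ^ n < (1 + a n) * d ^ n" by simp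
  also have "\<dots> \<le> d * d ^ n" using \<open>a n < d\<close> by (intro mult_right_mono) auto
  finally show ?case by (simp add: enc_def)
qed (simp add: enc_def)

lemma digit_enc:
  assumes "\<And>k. k < n \<Longrightarrow> a k < d" "l < n"
  shows "digit d (enc d n a) l = a l"
  using assms
proof (induction n)
  case (Suc n)
  have d: "d > 0" using Suc.prems by force
  have e: "enc d (Suc n) a = enc d n a + a n * d ^ n" by (simp add: enc_def)
  have less: "enc d n a < d ^ n" using Suc.prems by (intro enc_less) auto
  show ?case
  proof (cases "l = n")
    case True
    then show ?thesis using less Suc.prems(1)[of n] d by (simp add: digit_def e)
  next
    case False
    then have l: "l < n" using Suc.prems by simp
    \<comment> \<open>Since \<open>d ^ n\<close> is a multiple of \<open>d ^ Suc l\<close>, the top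
      summand does not affect digit \<open>l\<close>.\<close>
    then have "d ^ n = d ^ l * (d * d ^ (n - l - 1))"
      by (metis Suc_diff_Suc diff_diff_left le_add_diff_inverse less_imp_le plus_1_eq_Suc add.commute power_Suc power_add)
    then have "enc d (Suc n) a = enc d n a + d ^ l * (d * (a n * d ^ (n - l - 1)))"
      by (simp add: e mult_ac)
    then have "digit d (enc d (Suc n) a) l = digit d (enc d n a) l"
      using d by (simp add: digit_def)
    then show ?thesis using Suc.IH Suc.prems(1) l by simp
  qed
qed simp

lemma enc_digit: "enc d n (digit d x) = x mod d ^ n"
proof (induction n)
  case (Suc n)
  have "x mod d ^ Suc n = d ^ n * (x div d ^ n mod d) + x mod d ^ n"
    using mod_mult2_eq[of x "d ^ n" d] by (simp add: mult.commute)
  then show ?case using Suc by (simp add: enc_def digit_def mult.commute)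
qed (simp add: enc_def)

lemma digits_ext:
  assumes "x < d ^ n" "y < d ^ n" "\<And>l. l < n \<Longrightarrow> digit d x l = digit d y l"
  shows "x = y"
proof -
  have "enc d n (digit d x) = enc d n (digit d y)"
    unfolding enc_def using assms(3) by (intro sum.cong) auto
  then show ?thesis using assms(1,2) by (simp add: enc_digit)
qed

text \<open>A linear form over the residues modulo \<open>d\<close>, applied digit by digit. Integer
  coefficients admit the negative entries of an inverse matrix.\<close>

definition lin :: "nat \<Rightarrow> nat \<Rightarrow> int \<Rightarrow> int \<Rightarrow> nat \<Rightarrow> nat \<Rightarrow> nat" where
  "lin d n a b r t = enc d n (\<lambda>l. nat ((a * int (digit d r l) + b * int (digit d t l)) mod int d))"

text \<open>The action of the \<open>m\<close>-th power of \<open>X_k\<close> on basis indices; with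
  integer \<open>m\<close> the inverse is the shift by \<open>- m\<close>.\<close>

definition shift :: "nat \<Rightarrow> nat \<Rightarrow> nat \<Rightarrow> int \<Rightarrow> nat \<Rightarrow> nat" where
  "shift d n k m r = enc d n (\<lambda>l. nat ((int (digit d r l) + (if l = k then m else 0)) mod int d))"

context
  fixes d n :: nat
  assumes d: "d > 0"
begin

lemma nat_mod_less: "nat (x mod int d) < d"
  using d by (simp add: nat_less_iff)

lemma lin_less: "lin d n a b r t < d ^ n"
  unfolding lin_def by (rule enc_less) (rule nat_mod_less)

lemma shift_less: "shift d n k m r < d ^ n"
  unfolding shift_def by (rule enc_less) (rule nat_mod_less)

lemma digit_lin:
  "l < n \<Longrightarrow> int (digit d (lin d n a b r t) l) = (a * int (digit d r l) + b * int (digit d t l)) mod int d"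
  unfolding lin_def using d by (subst digit_enc) (auto simp: nat_mod_less)

lemma digit_shift:
  "l < n \<Longrightarrow> int (digit d (shift d n k m r) l) = (int (digit d r l) + (if l = k then m else 0)) mod int d"
  unfolding shift_def using d by (subst digit_enc) (auto simp: nat_mod_less)

lemma digits_ext_int:
  assumes "x < d ^ n" "y < d ^ n" "\<And>l. l < n \<Longrightarrow> int (digit d x l) = int (digit d y l)"
  shows "x = y"
  using assms by (intro digits_ext[of x d n y]) auto

lemma int_digit_mod: "int (digit d x l) mod int d = int (digit d x l)"
  using digit_less[OF d, of x l] by simp

text \<open>Coefficients compose as in a matrix product, which reduces inverting the basis map to
  inverting a 2 by 2 matrix modulo \<open>d\<close>.\<close>

lemma lin_lin:
  "lin d n a b (lin d n a1 b1 r t) (lin d n a2 b2 r t) = lin d n (a * a1 + b * a2) (a * b1 + b * b2) r t"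
proof (rule digits_ext_int[OF lin_less lin_less])
  fix l assume l: "l < n"
  let ?x = "int (digit d r l)" and ?y = "int (digit d t l)"
  have "(a * ((a1 * ?x + b1 * ?y) mod int d) + b * ((a2 * ?x + b2 * ?y) mod int d)) mod int d =
      (a * (a1 * ?x + b1 * ?y) + b * (a2 * ?x + b2 * ?y)) mod int d"
    by (intro mod_add_cong) (simp_all add: mod_mult_right_eq)
  then show "int (digit d (lin d n a b (lin d n a1 b1 r t) (lin d n a2 b2 r t)) l) =
      int (digit d (lin d n (a * a1 + b * a2) (a * b1 + b * b2) r t) l)"
    by (simp add: digit_lin[OF l] algebra_simps)
qed

lemma lin_cong:
  assumes "[a = a'] (mod int d)" "[b = b'] (mod int d)"
  shows "lin d n a b r t = lin d n a' b' r t"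
proof (rule digits_ext_int[OF lin_less lin_less])
  fix l assume l: "l < n"
  show "int (digit d (lin d n a b r t) l) = int (digit d (lin d n a' b' r t) l)"
    unfolding digit_lin[OF l] unfolding cong_def[symmetric]
    using assms by (intro cong_add cong_mult cong_refl)
qed

lemma lin_1_0: "r < d ^ n \<Longrightarrow> lin d n 1 0 r t = r"
  by (rule digits_ext_int[OF lin_less]) (auto simp: digit_lin int_digit_mod)

lemma lin_0_1: "t < d ^ n \<Longrightarrow> lin d n 0 1 r t = t"
  by (rule digits_ext_int[OF lin_less]) (auto simp: digit_lin int_digit_mod)

lemma shift_shift: "shift d n k m (shift d n k m' r) = shift d n k (m + m') r"
  by (rule digits_ext_int[OF shift_less shift_less]) (auto simp: digit_shift mod_simps algebra_simps)

lemma shift_cong: "[m = m'] (mod int d) \<Longrightarrow> shift d n k m r = shift d n k m' r"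
  by (rule digits_ext_int[OF shift_less shift_less])
    (auto simp: digit_shift cong_def[symmetric] intro!: cong_add)

lemma shift_0: "r < d ^ n \<Longrightarrow> shift d n k 0 r = r"
  by (rule digits_ext_int[OF shift_less]) (auto simp: digit_shift int_digit_mod)

lemma lin_shift: "lin d n a b (shift d n k m r) (shift d n k m' t) = shift d n k (a * m + b * m') (lin d n a b r t)"
proof (rule digits_ext_int[OF lin_less shift_less])
  fix l assume l: "l < n"
  let ?x = "int (digit d r l)" and ?y = "int (digit d t l)"
  have "(a * ((?x + m) mod int d) + b * ((?y + m') mod int d)) mod int d = (a * (?x + m) + b * (?y + m')) mod int d"
    by (intro mod_add_cong) (simp_all add: mod_mult_right_eq)
  moreover have "((a * ?x + b * ?y) mod int d + (a * m + b * m')) mod int d = (a * ?x + b * ?y + (a * m + b * m')) mod int d"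
    by (rule mod_add_left_eq)
  ultimately show "int (digit d (lin d n a b (shift d n k m r) (shift d n k m' t)) l) =
      int (digit d (shift d n k (a * m + b * m') (lin d n a b r t)) l)"
    using l by (cases "l = k") (auto simp: digit_lin digit_shift int_digit_mod algebra_simps)
qed

lemma shift_inverse:
  assumes "r < d ^ n"
  shows "shift d n k m (shift d n k (- m) r) = r" "shift d n k (- m) (shift d n k m r) = r"
  using assms by (simp_all add: shift_shift shift_0)

lemma bij_shift: "bij_betw (shift d n k m) {..<d ^ n} {..<d ^ n}"
  by (rule bij_betw_byWitness[where f' = "shift d n k (- m)"])
    (auto simp: shift_inverse shift_less)

lemma shift_eq_iff: "r < d ^ n \<Longrightarrow> x < d ^ n \<Longrightarrow> shift d n k m r = x \<longleftrightarrow> r = shift d n k (- m) x"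
  using shift_inverse by metis

end

section \<open>Dephasing in the Pauli bases\<close>

lemma chi_add: "chi d (x + y) = chi d x * chi d y"
  by (simp add: chi_def cis_mult add_divide_distrib distrib_left)

lemma chi_0 [simp]: "chi d 0 = 1"
  by (simp add: chi_def)

lemma chi_power: "chi d (int j * a) = chi d a ^ j"
  by (induction j) (simp_all add: chi_add distrib_right)

lemma chi_eq_1_iff:
  assumes "d > 0"
  shows "chi d a = 1 \<longleftrightarrow> int d dvd a"
proof
  assume "chi d a = 1"
  then have "cos (2 * pi * of_int a / real d) = 1" by (simp add: chi_def complex_eq_iff)
  then obtain x :: int where "2 * pi * of_int a / real d = of_int x * 2 * pi"
    using cos_one_2pi_int by blast
  then have "real_of_int a = real_of_int (x * int d)" using assms by (simp add: field_simps)
  then have "a = x * int d" by (simp only: of_int_eq_iff)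
  then show "int d dvd a" by simp
next
  assume "int d dvd a"
  then obtain x where x: "a = int d * x" by (auto elim: dvdE)
  then have "2 * pi * of_int a / real d = 2 * pi * of_int x" using assms by simp
  then show "chi d a = 1" by (simp add: chi_def)
qed

text \<open>A geometric sum whose ratio is either 1 or a nontrivial \<open>d\<close>-th root of
  unity.\<close>

lemma chi_sum:
  assumes "d > 0"
  shows "(\<Sum>j<d. chi d (int j * a)) = (if int d dvd a then of_nat d else 0)"
proof (cases "int d dvd a")
  case True
  then have "chi d a = 1" using chi_eq_1_iff[OF assms] by simp
  then show ?thesis using True by (simp add: chi_power)
next
  case False
  then have "chi d a \<noteq> 1" using chi_eq_1_iff[OF assms] by simp
  moreover have "chi d a ^ d = 1"
    using chi_eq_1_iff[OF assms, of "int d * a"] by (simp add: chi_power)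
  ultimately show ?thesis using False by (simp add: chi_power sum_gp_strict)
qed

lemma residue_class_count:
  assumes "d > 0"
  shows "(\<Sum>m<d. if int d dvd int m + x then f else 0) = (f :: complex)"
proof -
  define m0 where "m0 = nat ((- x) mod int d)"
  have m0: "m0 < d" "int m0 = (- x) mod int d" using assms by (auto simp: m0_def nat_less_iff)
  have "int d dvd int m + x \<longleftrightarrow> m = m0" if "m < d" for m
  proof -
    have "int d dvd int m + x \<longleftrightarrow> int m mod int d = (- x) mod int d"
      by (simp add: mod_eq_dvd_iff)
    also have "\<dots> \<longleftrightarrow> m = m0" using that by (simp flip: m0(2))
    finally show ?thesis .
  qed
  then have "(\<Sum>m<d. if int d dvd int m + x then f else 0) = (\<Sum>m<d. if m = m0 then f else 0)"
    by (intro sum.cong) auto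
  then show ?thesis using m0 by simp
qed

section \<open>Pauli powers and dephasing maps in coordinates\<close>

context
  fixes d n :: nat
  assumes d: "d > 0"
begin

lemma pauliZ_power:
  "pauliZ d n k ^\<^sub>m m = mat (d ^ n) (d ^ n) (\<lambda>(r,c). if r = c then chi d (int m * int (digit d c k)) else 0)"
proof (induction m)
  case 0
  show ?case by (intro eq_matI) (auto simp: pauliZ_def)
next
  case (Suc m)
  let ?P = "mat (d ^ n) (d ^ n) (\<lambda>(r,c). if r = c then chi d (int m * int (digit d c k)) else 0)"
  have "(?P * pauliZ d n k) $$ (r,c) = (if r = c then chi d (int (Suc m) * int (digit d c k)) else 0)"
    if "r < d ^ n" "c < d ^ n" for r c
  proof -
    have "(?P * pauliZ d n k) $$ (r,c) = (\<Sum>l<d ^ n. ?P $$ (r,l) * pauliZ d n k $$ (l,c))"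
      using that by (intro mult_index_sum) (auto simp: pauliZ_def)
    also have "\<dots> = (\<Sum>l<d ^ n. if l = c then (if r = c then chi d (int (Suc m) * int (digit d c k)) else 0) else 0)"
      using that by (intro sum.cong) (auto simp: pauliZ_def chi_add[symmetric] algebra_simps)
    finally show ?thesis using that by simp
  qed
  then show ?case using Suc by (intro eq_matI) (auto simp: pauliZ_def simp del: index_mult_mat(1))
qed

lemma pauliX_shift:
  assumes k: "k < n"
  shows "pauliX d n k = mat (d ^ n) (d ^ n) (\<lambda>(r,c). if r = shift d n k 1 c then 1 else 0)"
proof -
  have iff: "(digit d r k = (digit d c k + 1) mod d \<and> (\<forall>l<n. l \<noteq> k \<longrightarrow> digit d r l = digit d c l)) \<longleftrightarrow> r = shift d n k 1 c"
    if rc: "r < d ^ n" "c < d ^ n" for r c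
  proof
    assume h: "digit d r k = (digit d c k + 1) mod d \<and> (\<forall>l<n. l \<noteq> k \<longrightarrow> digit d r l = digit d c l)"
    show "r = shift d n k 1 c"
    proof (rule digits_ext_int[OF d rc(1) shift_less[OF d]])
      fix l assume l: "l < n"
      show "int (digit d r l) = int (digit d (shift d n k 1 c) l)"
        using h l by (cases "l = k") (auto simp: digit_shift[OF d] int_digit_mod[OF d] zmod_int add.commute)
    qed
  next
    assume r: "r = shift d n k 1 c"
    have "int (digit d r l) = (int (digit d c l) + (if l = k then 1 else 0)) mod int d" if "l < n" for l
      unfolding r by (rule digit_shift[OF d that])
    then have "int (digit d r l) = int ((digit d c l + (if l = k then 1 else 0)) mod d)" if "l < n" for l
      using that by (simp add: zmod_int)
    then have dig: "digit d r l = (digit d c l + (if l = k then 1 else 0)) mod d" if "l < n" for l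
      using that by (metis of_nat_eq_iff)
    show "digit d r k = (digit d c k + 1) mod d \<and> (\<forall>l<n. l \<noteq> k \<longrightarrow> digit d r l = digit d c l)"
      using dig[OF k] dig digit_less[OF d, of c] by auto
  qed
  show ?thesis unfolding pauliX_def by (intro cong_mat) (simp_all only: split iff)
qed

lemma pauliX_power:
  assumes k: "k < n"
  shows "pauliX d n k ^\<^sub>m m = mat (d ^ n) (d ^ n) (\<lambda>(r,c). if r = shift d n k (int m) c then 1 else 0)"
proof (induction m)
  case 0
  show ?case by (intro eq_matI) (auto simp: pauliX_def shift_0[OF d])
next
  case (Suc m)
  let ?P = "mat (d ^ n) (d ^ n) (\<lambda>(r,c). if r = shift d n k (int m) c then 1 else 0 :: complex)"
  have "(?P * pauliX d n k) $$ (r,c) = (if r = shift d n k (int (Suc m)) c then 1 else 0)"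
    if "r < d ^ n" "c < d ^ n" for r c
  proof -
    have "(?P * pauliX d n k) $$ (r,c) = (\<Sum>l<d ^ n. ?P $$ (r,l) * pauliX d n k $$ (l,c))"
      using that by (intro mult_index_sum) (auto simp: pauliX_def)
    also have "\<dots> = (\<Sum>l<d ^ n. if l = shift d n k 1 c then (if r = shift d n k (int m) (shift d n k 1 c) then 1 else 0) else 0)"
      unfolding pauliX_shift[OF k] using that by (intro sum.cong) auto
    also have "shift d n k (int m) (shift d n k 1 c) = shift d n k (int (Suc m)) c"
      by (simp add: shift_shift[OF d] add.commute)
    finally show ?thesis using shift_less[OF d] by simp
  qed
  then show ?case using Suc by (intro eq_matI) (auto simp: pauliX_def simp del: index_mult_mat(1))
qed

text \<open>Character orthogonality makes \<open>eigproj\<close> the projection onto the basis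
  vectors with \<open>k\<close>-th digit \<open>j\<close>, so dephasing erases the entries between
  different digits.\<close>

lemma dephase_Z:
  assumes \<rho>: "\<rho> \<in> carrier_mat (d ^ n) (d ^ n)"
  shows "dephase d n (pauliZ d n k) \<rho> =
    mat (d ^ n) (d ^ n) (\<lambda>(r,c). if digit d r k = digit d c k then \<rho> $$ (r,c) else 0)"
proof -
  let ?D = "d ^ n"
  have dig: "int d dvd int (digit d r k) - int j \<longleftrightarrow> digit d r k = j" if "j < d" for r j
  proof -
    have "int d dvd int (digit d r k) - int j \<longleftrightarrow> int (digit d r k) mod int d = int j mod int d"
      by (simp add: mod_eq_dvd_iff)
    then show ?thesis using that digit_less[OF d, of r k] by simp
  qed
  have P: "eigproj d n (pauliZ d n k) j = mat ?D ?D (\<lambda>(r,c). if r = c \<and> digit d c k = j then 1 else 0)"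
    if j: "j < d" for j
  proof -
    have "(\<Sum>m<d. chi d (- (int j * int m)) * (pauliZ d n k ^\<^sub>m m) $$ (r,c)) / of_nat d =
        (if r = c \<and> digit d c k = j then 1 else 0)" if rc: "r < ?D" "c < ?D" for r c
    proof -
      have "(\<Sum>m<d. chi d (- (int j * int m)) * (pauliZ d n k ^\<^sub>m m) $$ (r,c)) =
          (if r = c then (\<Sum>m<d. chi d (int m * (int (digit d c k) - int j))) else 0)"
        using rc by (auto simp: pauliZ_power chi_add[symmetric] algebra_simps)
      also have "\<dots> = (if r = c \<and> digit d c k = j then of_nat d else 0)"
        unfolding chi_sum[OF d] using dig[OF j] by auto
      finally show ?thesis using d by simp
    qed
    then show ?thesis unfolding eigproj_def by (intro cong_mat) (simp_all only: split)
  qed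
  have "(\<Sum>j<d. (eigproj d n (pauliZ d n k) j * \<rho> * eigproj d n (pauliZ d n k) j) $$ (r,c)) =
      (if digit d r k = digit d c k then \<rho> $$ (r,c) else 0)" if rc: "r < ?D" "c < ?D" for r c
  proof -
    have PrP: "(eigproj d n (pauliZ d n k) j * \<rho> * eigproj d n (pauliZ d n k) j) $$ (r,c) =
        (if digit d r k = j \<and> digit d c k = j then \<rho> $$ (r,c) else 0)" if j: "j < d" for j
    proof -
      let ?P = "mat ?D ?D (\<lambda>(r,c). if r = c \<and> digit d c k = j then 1 else 0 :: complex)"
      have 1: "(?P * \<rho>) $$ (r,y) = (if digit d r k = j then \<rho> $$ (r,y) else 0)" if "y < ?D" for y
      proof -
        have "(?P * \<rho>) $$ (r,y) = (\<Sum>l<?D. ?P $$ (r,l) * \<rho> $$ (l,y))"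
          using that rc \<rho> by (intro mult_index_sum) auto
        also have "\<dots> = (\<Sum>l<?D. if l = r then (if digit d r k = j then \<rho> $$ (r,y) else 0) else 0)"
          using rc by (intro sum.cong) auto
        finally show ?thesis using rc by simp
      qed
      have "(?P * \<rho> * ?P) $$ (r,c) = (\<Sum>l<?D. (?P * \<rho>) $$ (r,l) * ?P $$ (l,c))"
        using rc \<rho> by (intro mult_index_sum) auto
      also have "\<dots> = (\<Sum>l<?D. if l = c then (if digit d r k = j \<and> digit d c k = j then \<rho> $$ (r,c) else 0) else 0)"
        using rc by (intro sum.cong) (auto simp: 1 simp del: index_mult_mat(1))
      finally show ?thesis unfolding P[OF j] using rc by simp
    qed
    have "(\<Sum>j<d. (eigproj d n (pauliZ d n k) j * \<rho> * eigproj d n (pauliZ d n k) j) $$ (r,c)) =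
        (\<Sum>j<d. if j = digit d r k then (if digit d r k = digit d c k then \<rho> $$ (r,c) else 0) else 0)"
      by (intro sum.cong) (auto simp: PrP simp del: index_mult_mat(1))
    then show ?thesis using digit_less[OF d, of r k] by simp
  qed
  then show ?thesis unfolding dephase_def by (intro cong_mat) (simp_all only: split)
qed

text \<open>Expand both projectors in powers of \<open>X_k\<close>. The sum over \<open>j\<close>
  keeps only the exponents with \<open>m + m'\<close> divisible by \<open>d\<close>, which leaves
  the average over conjugations by powers of \<open>X_k\<close>.\<close>

lemma dephase_X:
  assumes \<rho>: "\<rho> \<in> carrier_mat (d ^ n) (d ^ n)" and k: "k < n"
  shows "dephase d n (pauliX d n k) \<rho> =
    mat (d ^ n) (d ^ n) (\<lambda>(r,c). (\<Sum>m<d. \<rho> $$ (shift d n k (int m) r, shift d n k (int m) c)) / of_nat d)"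
proof -
  let ?D = "d ^ n" and ?s = "\<lambda>m. shift d n k (int m)" and ?s' = "\<lambda>m. shift d n k (- int m)"
  define P where "P j = eigproj d n (pauliX d n k) j" for j
  have Pc: "P j \<in> carrier_mat ?D ?D" for j by (simp add: P_def eigproj_def)
  have P: "P j $$ (r,c) = (\<Sum>m<d. chi d (- (int j * int m)) * (if r = ?s m c then 1 else 0)) / of_nat d"
    if "r < ?D" "c < ?D" for j r c
    using that by (simp add: P_def eigproj_def pauliX_power[OF k])
  have 1: "(P j * \<rho>) $$ (r,y) = (\<Sum>m<d. chi d (- (int j * int m)) * \<rho> $$ (?s' m r, y)) / of_nat d"
    if "r < ?D" "y < ?D" for j r y
  proof -
    have "(P j * \<rho>) $$ (r,y) = (\<Sum>l<?D. P j $$ (r,l) * \<rho> $$ (l,y))"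
      by (rule mult_index_sum[OF Pc \<rho> that])
    also have "\<dots> = (\<Sum>l<?D. \<Sum>m<d. chi d (- (int j * int m)) * (if r = ?s m l then 1 else 0) * \<rho> $$ (l,y) / of_nat d)"
      using that by (intro sum.cong) (auto simp: P sum_distrib_right sum_divide_distrib)
    also have "\<dots> = (\<Sum>m<d. \<Sum>l<?D. chi d (- (int j * int m)) * (if r = ?s m l then 1 else 0) * \<rho> $$ (l,y) / of_nat d)"
      by (rule sum.swap)
    also have "\<dots> = (\<Sum>m<d. \<Sum>l<?D. if l = ?s' m r then chi d (- (int j * int m)) * \<rho> $$ (?s' m r,y) / of_nat d else 0)"
    proof (intro sum.cong refl)
      fix m l assume "l \<in> {..<?D}"
      then have "r = ?s m l \<longleftrightarrow> l = ?s' m r" using shift_eq_iff[OF d, of l n r k "int m"] that by auto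
      then show "chi d (- (int j * int m)) * (if r = ?s m l then 1 else 0) * \<rho> $$ (l,y) / of_nat d =
        (if l = ?s' m r then chi d (- (int j * int m)) * \<rho> $$ (?s' m r,y) / of_nat d else 0)" by simp
    qed
    finally show ?thesis using shift_less[OF d] by (simp add: sum_divide_distrib)
  qed
  have 2: "(P j * \<rho> * P j) $$ (r,c) =
      (\<Sum>m'<d. \<Sum>m<d. chi d (int j * - (int m + int m')) * \<rho> $$ (?s' m r, ?s m' c)) / (of_nat d * of_nat d)"
    if "r < ?D" "c < ?D" for j r c
  proof -
    have "(P j * \<rho> * P j) $$ (r,c) = (\<Sum>l<?D. (P j * \<rho>) $$ (r,l) * P j $$ (l,c))"
      by (rule mult_index_sum[OF mult_carrier_mat[OF Pc \<rho>] Pc that])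
    also have "\<dots> = (\<Sum>l<?D. \<Sum>m'<d. (P j * \<rho>) $$ (r,l) * (chi d (- (int j * int m')) * (if l = ?s m' c then 1 else 0)) / of_nat d)"
      using that by (intro sum.cong) (auto simp: P sum_distrib_left sum_divide_distrib simp del: index_mult_mat(1))
    also have "\<dots> = (\<Sum>m'<d. \<Sum>l<?D. (P j * \<rho>) $$ (r,l) * (chi d (- (int j * int m')) * (if l = ?s m' c then 1 else 0)) / of_nat d)"
      by (rule sum.swap)
    also have "\<dots> = (\<Sum>m'<d. \<Sum>l<?D. if l = ?s m' c then (P j * \<rho>) $$ (r,?s m' c) * chi d (- (int j * int m')) / of_nat d else 0)"
      by (intro sum.cong refl) auto
    also have "\<dots> = (\<Sum>m'<d. (P j * \<rho>) $$ (r,?s m' c) * chi d (- (int j * int m')) / of_nat d)"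
      using shift_less[OF d] by simp
    also have "\<dots> = (\<Sum>m'<d. \<Sum>m<d. chi d (int j * - (int m + int m')) * \<rho> $$ (?s' m r, ?s m' c) / (of_nat d * of_nat d))"
    proof (rule sum.cong[OF refl])
      fix m'
      have "chi d (int j * - (int m + int m')) = chi d (- (int j * int m)) * chi d (- (int j * int m'))" for m
        by (simp add: chi_add[symmetric] algebra_simps)
      then show "(P j * \<rho>) $$ (r,?s m' c) * chi d (- (int j * int m')) / of_nat d =
          (\<Sum>m<d. chi d (int j * - (int m + int m')) * \<rho> $$ (?s' m r, ?s m' c) / (of_nat d * of_nat d))"
        unfolding 1[OF that(1) shift_less[OF d]] by (simp add: sum_distrib_right sum_distrib_left sum_divide_distrib mult_ac)
    qed
    finally show ?thesis by (simp add: sum_divide_distrib)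
  qed
  show ?thesis unfolding dephase_def P_def[symmetric]
  proof (rule cong_mat, simp, simp, clarsimp simp del: index_mult_mat(1))
    fix r c assume rc: "r < ?D" "c < ?D"
    have "(\<Sum>j<d. (P j * \<rho> * P j) $$ (r,c)) =
        (\<Sum>j<d. \<Sum>m'<d. \<Sum>m<d. chi d (int j * - (int m + int m')) * \<rho> $$ (?s' m r, ?s m' c)) / (of_nat d * of_nat d)"
      using 2[OF rc] by (simp add: sum_divide_distrib del: index_mult_mat(1))
    also have "(\<Sum>j<d. \<Sum>m'<d. \<Sum>m<d. chi d (int j * - (int m + int m')) * \<rho> $$ (?s' m r, ?s m' c)) =
        (\<Sum>m'<d. \<Sum>j<d. \<Sum>m<d. chi d (int j * - (int m + int m')) * \<rho> $$ (?s' m r, ?s m' c))"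
      by (rule sum.swap)
    also have "\<dots> = (\<Sum>m'<d. \<Sum>m<d. \<Sum>j<d. chi d (int j * - (int m + int m')) * \<rho> $$ (?s' m r, ?s m' c))"
      by (intro sum.cong refl sum.swap)
    also have "\<dots> = (\<Sum>m'<d. \<Sum>m<d. if int d dvd int m + int m' then of_nat d * \<rho> $$ (?s m' r, ?s m' c) else 0)"
    proof (intro sum.cong refl)
      fix m m'
      have "(\<Sum>j<d. chi d (int j * - (int m + int m')) * \<rho> $$ (?s' m r, ?s m' c)) =
          (if int d dvd int m + int m' then of_nat d else 0) * \<rho> $$ (?s' m r, ?s m' c)"
        unfolding sum_distrib_right[symmetric] chi_sum[OF d] by (simp only: dvd_minus_iff)
      \<comment> \<open>For surviving pairs \<open>- m\<close> and \<open>m'\<close> are congruent,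
        so row and column are moved by the same shift.\<close>
      moreover have "?s' m r = ?s m' r" if "int d dvd int m + int m'"
        using that by (intro shift_cong[OF d]) (simp add: cong_iff_dvd_diff dvd_diff_commute[of _ "- int m"] add.commute)
      ultimately show "(\<Sum>j<d. chi d (int j * - (int m + int m')) * \<rho> $$ (?s' m r, ?s m' c)) =
          (if int d dvd int m + int m' then of_nat d * \<rho> $$ (?s m' r, ?s m' c) else 0)" by auto
    qed
    also have "\<dots> = (\<Sum>m'<d. of_nat d * \<rho> $$ (?s m' r, ?s m' c))"
      by (intro sum.cong refl residue_class_count[OF d])
    finally show "(\<Sum>j<d. (P j * \<rho> * P j) $$ (r,c)) = (\<Sum>m<d. \<rho> $$ (?s m r, ?s m c)) / of_nat d"
      using d by (simp add: sum_distrib_left[symmetric] del: index_mult_mat(1))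
  qed
qed

text \<open>Dephasing is itself a channel, with the digit projections as Kraus operators.\<close>

lemma dephase_Z_density:
  assumes "density (d ^ n) \<rho>"
  shows "density (d ^ n) (dephase d n (pauliZ d n k) \<rho>)"
proof -
  let ?D = "d ^ n"
  have \<rho>: "\<rho> \<in> carrier_mat ?D ?D" using assms by (simp add: density_def psd_def hermitian_def)
  define a where "a j r = (if digit d r k = j then 1 else 0 :: complex)" for j r
  let ?K = "\<lambda>j. mat ?D ?D (\<lambda>(r,x). if x = r then a j r else 0)"
  have norm: "(\<Sum>j<d. \<Sum>r<?D. if r = x then a j r * cnj (a j r) else 0) = 1" if "x < ?D" for x
  proof -
    have "a j r * cnj (a j r) = (if j = digit d r k then 1 else 0)" for j r by (simp add: a_def)
    then show ?thesis using that digit_less[OF d, of x k] by simp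
  qed
  have "kraus_map ?D {..<d} ?K \<rho> = mat ?D ?D (\<lambda>(r,c). \<Sum>j<d. a j r * cnj (a j c) * \<rho> $$ (r,c))"
    using norm \<rho> by (intro monomial_kraus(2)[where f = "\<lambda>j r. r"]) auto
  also have "\<dots> = dephase d n (pauliZ d n k) \<rho>"
    unfolding dephase_Z[OF \<rho>]
  proof (rule cong_mat, simp, simp, clarify)
    fix r c
    have "(\<Sum>j<d. a j r * cnj (a j c) * \<rho> $$ (r,c)) = (\<Sum>j<d. if j = digit d r k then (if digit d r k = digit d c k then \<rho> $$ (r,c) else 0) else 0)"
      by (intro sum.cong) (auto simp: a_def)
    then show "(\<Sum>j<d. a j r * cnj (a j c) * \<rho> $$ (r,c)) = (if digit d r k = digit d c k then \<rho> $$ (r,c) else 0)"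
      using digit_less[OF d, of r k] by simp
  qed
  finally have "kraus_map ?D {..<d} ?K \<rho> = dephase d n (pauliZ d n k) \<rho>" .
  moreover have "kraus_family ?D {..<d} ?K"
    using norm by (intro monomial_kraus(1)[where f = "\<lambda>j r. r"]) auto
  ultimately show ?thesis using kraus_map_density[of ?D "{..<d}" ?K \<rho>] assms by simp
qed

text \<open>Here the Kraus operators are the \<open>d\<close> shifts of digit \<open>k\<close>, with
  equal amplitudes whose squares are \<open>1 / d\<close>.\<close>

lemma dephase_X_density:
  assumes "density (d ^ n) \<rho>" and k: "k < n"
  shows "density (d ^ n) (dephase d n (pauliX d n k) \<rho>)"
proof -
  let ?D = "d ^ n" and ?s = "\<lambda>m. shift d n k (int m)"
  have \<rho>: "\<rho> \<in> carrier_mat ?D ?D" using assms by (simp add: density_def psd_def hermitian_def)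
  define a where "a = complex_of_real (1 / sqrt (real d))"
  have aa: "a * cnj a = 1 / of_nat d" using d by (simp add: a_def flip: of_real_mult)
  let ?K = "\<lambda>m. mat ?D ?D (\<lambda>(r,x). if x = ?s m r then a else 0)"
  have norm: "(\<Sum>m<d. \<Sum>r<?D. if ?s m r = x then a * cnj a else 0) = 1" if x: "x < ?D" for x
  proof -
    have "(\<Sum>r<?D. if ?s m r = x then a * cnj a else 0) = 1 / of_nat d" for m
    proof -
      have "(\<Sum>r<?D. if ?s m r = x then a * cnj a else 0) = (\<Sum>r<?D. if r = shift d n k (- int m) x then 1 / of_nat d else 0)"
        using shift_eq_iff[OF d _ x] by (intro sum.cong) (auto simp: aa)
      then show ?thesis using shift_less[OF d] by simp
    qed
    then show ?thesis using d by simp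
  qed
  have "kraus_map ?D {..<d} ?K \<rho> = mat ?D ?D (\<lambda>(r,c). \<Sum>m<d. a * cnj a * \<rho> $$ (?s m r, ?s m c))"
    using norm \<rho> shift_less[OF d] by (intro monomial_kraus(2)[where a = "\<lambda>m r. a"]) auto
  also have "\<dots> = dephase d n (pauliX d n k) \<rho>"
    unfolding dephase_X[OF \<rho> k] by (intro cong_mat) (auto simp: aa sum_divide_distrib)
  finally have "kraus_map ?D {..<d} ?K \<rho> = dephase d n (pauliX d n k) \<rho>" .
  moreover have "kraus_family ?D {..<d} ?K"
    using norm shift_less[OF d] by (intro monomial_kraus(1)[where a = "\<lambda>m r. a"]) auto
  ultimately show ?thesis using kraus_map_density[of ?D "{..<d}" ?K \<rho>] assms by simp
qed

end

section \<open>The convolution\<close>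

text \<open>Multiplication by a unit permutes the residues modulo \<open>d\<close>.\<close>

lemma sum_mult_residues:
  fixes F :: "int \<Rightarrow> complex"
  assumes p: "prime d" and u: "\<not> int d dvd u"
    and per: "\<And>x y. [x = y] (mod int d) \<Longrightarrow> F x = F y"
  shows "(\<Sum>m<d. F (u * int m)) = (\<Sum>m<d. F (int m))"
proof -
  have d: "d > 0" using p prime_gt_0_nat by blast
  define g where "g m = nat ((u * int m) mod int d)" for m
  have g_int: "int (g m) = (u * int m) mod int d" for m using d by (simp add: g_def)
  have g_less: "g m < d" for m using d by (simp add: g_def nat_less_iff)
  have "inj_on g {..<d}"
  proof (rule inj_onI)
    fix x y assume xy: "x \<in> {..<d}" "y \<in> {..<d}" "g x = g y"
    then have "[u * int x = u * int y] (mod int d)" using g_int by (metis cong_def)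
    moreover have "coprime u (int d)" using p u
      by (metis coprime_commute prime_imp_coprime prime_nat_int_transfer)
    ultimately have "[int x = int y] (mod int d)" using cong_mult_lcancel by blast
    then show "x = y" using xy by (simp add: cong_def)
  qed
  moreover have "g ` {..<d} = {..<d}"
    by (rule card_subset_eq) (use g_less card_image[OF calculation] in auto)
  ultimately have "bij_betw g {..<d} {..<d}" by (simp add: bij_betw_def)
  then have "(\<Sum>m<d. F (int m)) = (\<Sum>m<d. F (int (g m)))" by (rule sum.reindex_bij_betw[symmetric])
  also have "\<dots> = (\<Sum>m<d. F (u * int m))"
    by (intro sum.cong refl per) (simp add: g_int cong_def)
  finally show ?thesis ..
qed

lemma prime_inverse_exists:
  assumes "prime d" "\<not> int d dvd b"
  shows "\<exists>v. [b * v = 1] (mod int d)"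
proof -
  have "coprime b (int d)" using assms
    by (metis coprime_commute prime_imp_coprime prime_nat_int_transfer)
  then show ?thesis by (rule cong_solve_coprime_int)
qed

lemma couple_carrier: "couple D \<alpha> \<beta> A B \<in> carrier_mat D D"
  by (simp add: couple_def)

text \<open>For fixed \<open>t\<close> the \<open>k\<close>-th digits of \<open>a r + b t\<close>
  and \<open>a c + b t\<close> agree exactly when those of \<open>r\<close> and \<open>c\<close> do,
  since \<open>a\<close> is invertible. The mask of the dephasing thus passes from the output to the
  input \<open>A\<close>.\<close>

lemma couple_dephase_Z:
  assumes p: "prime d" and A: "A \<in> carrier_mat (d ^ n) (d ^ n)" and k: "k < n" and a: "\<not> int d dvd a"
  shows "dephase d n (pauliZ d n k) (couple (d ^ n) (lin d n a b) \<beta> A B) =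
    couple (d ^ n) (lin d n a b) \<beta> (dephase d n (pauliZ d n k) A) B"
proof -
  have d: "d > 0" using p prime_gt_0_nat by blast
  let ?D = "d ^ n" and ?\<alpha> = "lin d n a b"
  have eq: "digit d (?\<alpha> r t) k = digit d (?\<alpha> c t) k \<longleftrightarrow> digit d r k = digit d c k" for r c t
  proof -
    let ?x = "int (digit d r k)" and ?y = "int (digit d c k)" and ?z = "int (digit d t k)"
    have "digit d (?\<alpha> r t) k = digit d (?\<alpha> c t) k \<longleftrightarrow> (a * ?x + b * ?z) mod int d = (a * ?y + b * ?z) mod int d"
      using digit_lin[OF d k] by (metis of_nat_eq_iff)
    also have "\<dots> \<longleftrightarrow> int d dvd a * (?x - ?y)" by (simp add: mod_eq_dvd_iff algebra_simps)
    also have "\<dots> \<longleftrightarrow> int d dvd ?x - ?y"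
      using p a by (meson dvd_mult prime_dvd_multD prime_nat_int_transfer)
    also have "\<dots> \<longleftrightarrow> ?x mod int d = ?y mod int d" by (simp add: mod_eq_dvd_iff)
    also have "\<dots> \<longleftrightarrow> digit d r k = digit d c k" by (simp add: int_digit_mod[OF d])
    finally show ?thesis .
  qed
  have "(if digit d r k = digit d c k then couple ?D ?\<alpha> \<beta> A B $$ (r,c) else 0) =
    (\<Sum>t<?D. dephase d n (pauliZ d n k) A $$ (?\<alpha> r t, ?\<alpha> c t) * B $$ (\<beta> r t, \<beta> c t))" if "r < ?D" "c < ?D" for r c
    using that lin_less[OF d, of n] by (simp add: dephase_Z[OF d A] eq couple_def)
  then show ?thesis
    unfolding dephase_Z[OF d couple_carrier] unfolding couple_def[of _ _ _ "dephase d n (pauliZ d n k) A"]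
    by (intro cong_mat) (simp_all only: split)
qed

text \<open>Shifting the output digit \<open>r\<close> by \<open>m\<close> and the traced-out digit \<open>t\<close> by \<open>- v a' m\<close>, where
  \<open>b' v = 1\<close>, fixes \<open>\<beta>\<close> and shifts \<open>\<alpha>\<close> by a nonzero multiple of \<open>m\<close>.\<close>
lemma couple_dephase_X:
  assumes p: "prime d" and A: "A \<in> carrier_mat (d ^ n) (d ^ n)" and k: "k < n"
    and b': "\<not> int d dvd b'" and det: "\<not> int d dvd a * b' - b * a'"
  shows "dephase d n (pauliX d n k) (couple (d ^ n) (lin d n a b) (lin d n a' b') A B) =
    couple (d ^ n) (lin d n a b) (lin d n a' b') (dephase d n (pauliX d n k) A) B"
proof -
  have d: "d > 0" using p prime_gt_0_nat by blast
  let ?D = "d ^ n" and ?\<alpha> = "lin d n a b" and ?\<beta> = "lin d n a' b'" and ?s = "shift d n k"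
  obtain v where v: "[b' * v = 1] (mod int d)" using prime_inverse_exists[OF p b'] by blast
  define u where "u = a - b * v * a'"
  \<comment> \<open>Modulo \<open>d\<close>, \<open>b' * u\<close> is the determinant.\<close>
  have u: "\<not> int d dvd u"
  proof
    assume "int d dvd u"
    then have "int d dvd b' * u" by simp
    moreover have "int d dvd b * a' * (b' * v - 1)" using v by (simp add: cong_iff_dvd_diff)
    ultimately have "int d dvd b' * u + b * a' * (b' * v - 1)" by (rule dvd_add)
    then show False using det by (simp add: u_def algebra_simps)
  qed
  \<comment> \<open>Reindexing the trace variable by the compensating shift changes nothing in the
    sum but removes the shift from the argument of \<open>B\<close>.\<close>
  have key: "(\<Sum>t<?D. A $$ (?\<alpha> (?s m r) t, ?\<alpha> (?s m c) t) * B $$ (?\<beta> (?s m r) t, ?\<beta> (?s m c) t)) =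
      (\<Sum>t<?D. A $$ (?s (u * m) (?\<alpha> r t), ?s (u * m) (?\<alpha> c t)) * B $$ (?\<beta> r t, ?\<beta> c t))" for m r c
  proof -
    define m' where "m' = - (v * a' * m)"
    have \<alpha>: "?\<alpha> (?s m x) (?s m' t) = ?s (u * m) (?\<alpha> x t)" for x t
      by (simp add: lin_shift[OF d] m'_def u_def algebra_simps)
    have \<beta>: "?\<beta> (?s m x) (?s m' t) = ?\<beta> x t" for x t
    proof -
      have "int d dvd a' * m * (1 - b' * v)" using v by (metis cong_iff_dvd_diff cong_sym dvd_mult)
      then have "[a' * m + b' * m' = 0] (mod int d)"
        by (simp add: cong_iff_dvd_diff m'_def algebra_simps)
      then show ?thesis
        using shift_cong[OF d] by (simp add: lin_shift[OF d] shift_0[OF d lin_less[OF d]])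
    qed
    have "(\<Sum>t<?D. A $$ (?\<alpha> (?s m r) t, ?\<alpha> (?s m c) t) * B $$ (?\<beta> (?s m r) t, ?\<beta> (?s m c) t)) =
      (\<Sum>t<?D. A $$ (?\<alpha> (?s m r) (?s m' t), ?\<alpha> (?s m c) (?s m' t)) * B $$ (?\<beta> (?s m r) (?s m' t), ?\<beta> (?s m c) (?s m' t)))"
      by (rule sum.reindex_bij_betw[OF bij_shift[OF d], symmetric])
    then show ?thesis unfolding \<alpha> \<beta> .
  qed
  have "(\<Sum>m<d. couple ?D ?\<alpha> ?\<beta> A B $$ (?s (int m) r, ?s (int m) c)) / of_nat d =
    (\<Sum>t<?D. dephase d n (pauliX d n k) A $$ (?\<alpha> r t, ?\<alpha> c t) * B $$ (?\<beta> r t, ?\<beta> c t))"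
    if "r < ?D" "c < ?D" for r c
  proof -
    define F where "F m = (\<Sum>t<?D. A $$ (?s m (?\<alpha> r t), ?s m (?\<alpha> c t)) * B $$ (?\<beta> r t, ?\<beta> c t))" for m
    have per: "F x = F y" if "[x = y] (mod int d)" for x y
      unfolding F_def using shift_cong[OF d that, of n k] by simp
    have "(\<Sum>m<d. couple ?D ?\<alpha> ?\<beta> A B $$ (?s (int m) r, ?s (int m) c)) = (\<Sum>m<d. F (u * int m))"
      using shift_less[OF d, of n k] by (simp add: couple_def key F_def)
    also have "\<dots> = (\<Sum>m<d. F (int m))" by (rule sum_mult_residues[OF p u per])
    also have "\<dots> = (\<Sum>t<?D. \<Sum>m<d. A $$ (?s (int m) (?\<alpha> r t), ?s (int m) (?\<alpha> c t)) * B $$ (?\<beta> r t, ?\<beta> c t))"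
      unfolding F_def by (rule sum.swap)
    finally show ?thesis using lin_less[OF d, of n]
      by (simp add: dephase_X[OF d A k] sum_divide_distrib sum_distrib_right)
  qed
  then show ?thesis
    unfolding dephase_X[OF d couple_carrier k] unfolding couple_def[of _ _ _ "dephase d n (pauliX d n k) A"]
    by (intro cong_mat) (simp_all only: split)
qed

text \<open>\<open>N\<close> times the adjugate of the coefficient matrix is its two-sided inverse
  modulo \<open>d\<close>.\<close>

lemma lin_bij:
  assumes d: "d > 0" and N: "[N * (a * b' - b * a') = 1] (mod int d)"
  shows "r < d ^ n \<Longrightarrow> lin d n (N * b') (- N * b) (lin d n a b r t) (lin d n a' b' r t) = r"
    and "t < d ^ n \<Longrightarrow> lin d n (- N * a') (N * a) (lin d n a b r t) (lin d n a' b' r t) = t"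
    and "r < d ^ n \<Longrightarrow> lin d n a b (lin d n (N * b') (- N * b) r t) (lin d n (- N * a') (N * a) r t) = r"
    and "t < d ^ n \<Longrightarrow> lin d n a' b' (lin d n (N * b') (- N * b) r t) (lin d n (- N * a') (N * a) r t) = t"
proof -
  have 1: "lin d n x y r t = lin d n 1 0 r t" if "x = N * (a * b' - b * a')" "y = 0" for x y r t
    using N that by (intro lin_cong[OF d]) auto
  have 2: "lin d n x y r t = lin d n 0 1 r t" if "x = 0" "y = N * (a * b' - b * a')" for x y r t
    using N that by (intro lin_cong[OF d]) auto
  show "r < d ^ n \<Longrightarrow> lin d n (N * b') (- N * b) (lin d n a b r t) (lin d n a' b' r t) = r"
    unfolding lin_lin[OF d] by (subst 1) (auto simp: lin_1_0[OF d] algebra_simps)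
  show "t < d ^ n \<Longrightarrow> lin d n (- N * a') (N * a) (lin d n a b r t) (lin d n a' b' r t) = t"
    unfolding lin_lin[OF d] by (subst 2) (auto simp: lin_0_1[OF d] algebra_simps)
  show "r < d ^ n \<Longrightarrow> lin d n a b (lin d n (N * b') (- N * b) r t) (lin d n (- N * a') (N * a) r t) = r"
    unfolding lin_lin[OF d] by (subst 1) (auto simp: lin_1_0[OF d] algebra_simps)
  show "t < d ^ n \<Longrightarrow> lin d n a' b' (lin d n (N * b') (- N * b) r t) (lin d n (- N * a') (N * a) r t) = t"
    unfolding lin_lin[OF d] by (subst 2) (auto simp: lin_0_1[OF d] algebra_simps)
qed

lemma bij_lin:
  assumes d: "d > 0" and N: "[N * (a * b' - b * a') = 1] (mod int d)"
  shows "bij_betw (\<lambda>(r,t). (lin d n a b r t, lin d n a' b' r t)) ({..<d ^ n} \<times> {..<d ^ n}) ({..<d ^ n} \<times> {..<d ^ n})"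
  by (rule bij_betw_byWitness[where f' = "\<lambda>(r,t). (lin d n (N * b') (- N * b) r t, lin d n (- N * a') (N * a) r t)"])
    (use lin_bij[OF d N, where n = n] lin_less[OF d, of n] in auto)

text \<open>\<open>U\<close> is the permutation matrix of \<open>f\<close>, so conjugation reads
  each entry at the preimages given by \<open>g\<close>.\<close>

lemma permutation_conj:
  fixes f g :: "nat \<Rightarrow> nat"
  assumes g: "\<And>r. r < m \<Longrightarrow> g r < m" and fg: "\<And>r. r < m \<Longrightarrow> f (g r) = r" and gf: "\<And>r. r < m \<Longrightarrow> g (f r) = r"
    and M: "M \<in> carrier_mat m m" and rc: "r < m" "c < m"
  defines "U \<equiv> mat m m (\<lambda>(r,c). if r = f c then 1 else 0)"
  shows "(U * M * adj U) $$ (r,c) = M $$ (g r, g c)"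
proof -
  have U: "U \<in> carrier_mat m m" by (simp add: U_def)
  have Ui: "U $$ (r,l) = (if l = g r then 1 else 0)" if "r < m" "l < m" for r l
    using that fg gf by (auto simp: U_def)
  have UM: "(U * M) $$ (r,y) = M $$ (g r, y)" if "y < m" for y
  proof -
    have "(U * M) $$ (r,y) = (\<Sum>l<m. U $$ (r,l) * M $$ (l,y))" by (rule mult_index_sum[OF U M rc(1) that])
    also have "\<dots> = (\<Sum>l<m. if l = g r then M $$ (g r, y) else 0)"
      using rc by (intro sum.cong) (auto simp: Ui)
    finally show ?thesis using g rc by simp
  qed
  have "(U * M * adj U) $$ (r,c) = (\<Sum>l<m. (U * M) $$ (r,l) * cnj (U $$ (c,l)))"
    by (rule mult_adj_index[OF mult_carrier_mat[OF U M] U rc])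
  also have "\<dots> = (\<Sum>l<m. if l = g c then M $$ (g r, g c) else 0)"
    using rc by (intro sum.cong) (auto simp: Ui UM simp del: index_mult_mat(1))
  finally show ?thesis using g rc by simp
qed

lemma Ninv_cong:
  assumes "prime d" "invertible_mod d G"
  shows "[Ninv d G * detG G = 1] (mod int d)"
proof -
  have "\<exists>N. (N * detG G) mod int d = 1 mod int d"
    using prime_inverse_exists[OF assms(1), of "detG G"] assms(2)
    by (auto simp: invertible_mod_def cong_def mult.commute)
  then show ?thesis unfolding Ninv_def cong_def by (rule someI_ex)
qed

lemma pair_index_less: "x < D \<Longrightarrow> y < D \<Longrightarrow> x * D + y < D * (D::nat)"
proof -
  assume "x < D" "y < D"
  then have "x * D + y < Suc x * D" by simp
  also have "\<dots> \<le> D * D" using \<open>x < D\<close> by (intro mult_right_mono) auto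
  finally show ?thesis .
qed

text \<open>The inverse of the key permutation has the transpose of \<open>G\<close> as its
  coefficient matrix. Conjugating by the permutation evaluates \<open>kron A B\<close> at the
  preimages, and the partial trace sums over \<open>t\<close>.\<close>

lemma boxtimes_couple:
  assumes p: "prime d" and G: "invertible_mod d G"
    and A: "A \<in> carrier_mat (d ^ n) (d ^ n)" and B: "B \<in> carrier_mat (d ^ n) (d ^ n)"
  shows "boxtimes d n G A B = couple (d ^ n) (lin d n (G $$ (0,0)) (G $$ (1,0))) (lin d n (G $$ (0,1)) (G $$ (1,1))) A B"
proof -
  have d: "d > 0" using p prime_gt_0_nat by blast
  define D where "D = d ^ n"
  have D: "D > 0" using d by (simp add: D_def)
  define N where "N = Ninv d G"
  let ?\<alpha> = "lin d n (G $$ (0,0)) (G $$ (1,0))" and ?\<beta> = "lin d n (G $$ (0,1)) (G $$ (1,1))"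
  let ?\<alpha>' = "lin d n (N * G $$ (1,1)) (- N * G $$ (1,0))" and ?\<beta>' = "lin d n (- N * G $$ (0,1)) (N * G $$ (0,0))"
  have N: "[N * (G $$ (0,0) * G $$ (1,1) - G $$ (1,0) * G $$ (0,1)) = 1] (mod int d)"
    using Ninv_cong[OF p G] by (simp add: N_def detG_def mult.commute)
  note inv = lin_bij[OF d N, where n = n, folded D_def]
  \<comment> \<open>\<open>f\<close> is the key permutation on flattened pair indices, and
    \<open>g\<close> is its inverse.\<close>
  define f where "f c = ?\<alpha>' (c div D) (c mod D) * D + ?\<beta>' (c div D) (c mod D)" for c
  define g where "g c = ?\<alpha> (c div D) (c mod D) * D + ?\<beta> (c div D) (c mod D)" for c
  have less: "lin d n x y r t < D" for x y r t using lin_less[OF d] by (simp add: D_def)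
  have dm: "c div D < D" "c mod D < D" if "c < D * D" for c
    using that D by (simp_all add: less_mult_imp_div_less)
  have keyU: "keyU d n G = mat (D * D) (D * D) (\<lambda>(r,c). if r = f c then 1 else 0)"
    unfolding keyU_def f_def D_def[symmetric] keyperm_def Let_def N_def[symmetric] lin_def by simp
  have "(keyU d n G * kron A B * adj (keyU d n G)) $$ (r * D + t, c * D + t) =
      A $$ (?\<alpha> r t, ?\<alpha> c t) * B $$ (?\<beta> r t, ?\<beta> c t)" if rct: "r < D" "c < D" "t < D" for r c t
  proof -
    have "(keyU d n G * kron A B * adj (keyU d n G)) $$ (r * D + t, c * D + t) =
        kron A B $$ (g (r * D + t), g (c * D + t))"
      unfolding keyU
    proof (rule permutation_conj)
      show "g r < D * D" if "r < D * D" for r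
        unfolding g_def by (intro pair_index_less less)
      show "f (g r) = r" if "r < D * D" for r
        using less dm[OF that] inv(1,2) by (simp add: f_def g_def)
      show "g (f r) = r" if "r < D * D" for r
        using less dm[OF that] inv(3,4) by (simp add: f_def g_def)
      show "kron A B \<in> carrier_mat (D * D) (D * D)" using A B by (simp add: kron_def D_def)
    qed (use rct in \<open>auto intro: pair_index_less\<close>)
    also have "\<dots> = A $$ (?\<alpha> r t, ?\<alpha> c t) * B $$ (?\<beta> r t, ?\<beta> c t)"
      using rct less A B pair_index_less[OF less less] by (simp add: kron_def g_def D_def[symmetric])
    finally show ?thesis .
  qed
  then show ?thesis
    unfolding boxtimes_def ptrB_def couple_def D_def[symmetric]
    by (intro cong_mat) auto
qed

text \<open>With \<open>B\<close> fixed the coupling is a channel that commutes with both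
  dephasings: \<open>a\<close> invertible gives this for \<open>Z\<close>, and \<open>b'\<close>
  together with the determinant for \<open>X\<close>. Data processing then applies to each of the
  four entropies at every qudit.\<close>

theorem Jfun_couple_le:
  assumes p: "prime d" and A: "density (d ^ n) A" and B: "density (d ^ n) B"
    and a: "\<not> int d dvd a" and b': "\<not> int d dvd b'" and det: "\<not> int d dvd a * b' - b * a'"
  shows "Jfun d n (couple (d ^ n) (lin d n a b) (lin d n a' b') A B) \<le> Jfun d n A"
proof -
  have d: "d > 0" using p prime_gt_0_nat by blast
  let ?D = "d ^ n" and ?L = "\<lambda>A. couple (d ^ n) (lin d n a b) (lin d n a' b') A B"
  have carrier: "X \<in> carrier_mat ?D ?D" if "density ?D X" for X
    using that by (simp add: density_def psd_def hermitian_def)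
  obtain N where "[N * (a * b' - b * a') = 1] (mod int d)"
    using prime_inverse_exists[OF p det] by (auto simp: mult.commute)
  from couple_kraus[OF B bij_lin[OF d this]] obtain K where
    K: "kraus_family ?D ({..<?D} \<times> {..<?D}) K" "\<And>X. X \<in> carrier_mat ?D ?D \<Longrightarrow> ?L X = kraus_map ?D ({..<?D} \<times> {..<?D}) K X"
    by blast
  have dpi: "rel_ent ?D (?L X) (?L Y) \<le> rel_ent ?D X Y" if "density ?D X" "density ?D Y" for X Y
    using data_processing_inequality[OF K(1) that(1), of Y] that K(2) carrier by (simp add: density_def)
  have "rel_ent ?D (?L A) (dephase d n (pauliX d n k) (?L A)) \<le> rel_ent ?D A (dephase d n (pauliX d n k) A)"
    "rel_ent ?D (dephase d n (pauliX d n k) (?L A)) (?L A) \<le> rel_ent ?D (dephase d n (pauliX d n k) A) A"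
    "rel_ent ?D (?L A) (dephase d n (pauliZ d n k) (?L A)) \<le> rel_ent ?D A (dephase d n (pauliZ d n k) A)"
    "rel_ent ?D (dephase d n (pauliZ d n k) (?L A)) (?L A) \<le> rel_ent ?D (dephase d n (pauliZ d n k) A) A"
    if k: "k < n" for k
    \<comment> \<open>Commutation turns each dephased output into the image of a dephased input, so
      both arguments on the left are images under the same channel.\<close>
    unfolding couple_dephase_X[OF p carrier[OF A] k b' det] couple_dephase_Z[OF p carrier[OF A] k a]
    by (intro dpi A dephase_X_density[OF d A k] dephase_Z_density[OF d A])+
  then show ?thesis
    unfolding Jfun_def by (intro ereal_mult_left_mono sum_mono add_mono) auto
qed

theorem mainTheorem13:
  fixes d n :: nat and G :: "int mat" and \<rho>A \<rho>B :: "complex mat"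
  assumes "prime d" and "n \<ge> 1" and "invertible_mod d G"
    and "density (d ^ n) \<rho>A" and "density (d ^ n) \<rho>B"
  shows "(odd_pos d G \<longrightarrow> Jfun d n (boxtimes d n G \<rho>A \<rho>B) \<le> Jfun d n \<rho>B)
       \<and> (even_pos d G \<longrightarrow> Jfun d n (boxtimes d n G \<rho>A \<rho>B) \<le> Jfun d n \<rho>A)
       \<and> (positive d G \<longrightarrow> Jfun d n (boxtimes d n G \<rho>A \<rho>B) \<le> min (Jfun d n \<rho>A) (Jfun d n \<rho>B))"
proof -
  have carrier: "\<rho>A \<in> carrier_mat (d ^ n) (d ^ n)" "\<rho>B \<in> carrier_mat (d ^ n) (d ^ n)"
    using assms by (simp_all add: density_def psd_def hermitian_def)
  note box = boxtimes_couple[OF assms(1,3) carrier]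
  have det: "\<not> int d dvd G $$ (0,0) * G $$ (1,1) - G $$ (1,0) * G $$ (0,1)"
    using assms(3) by (simp add: invertible_mod_def detG_def mult.commute)
  \<comment> \<open>Exchanging the two inputs swaps the rows of the coefficient matrix and so
    negates the determinant.\<close>
  then have det': "\<not> int d dvd G $$ (0,1) * G $$ (1,0) - G $$ (1,1) * G $$ (0,0)"
    by (simp add: dvd_diff_commute mult.commute)
  \<comment> \<open>With \<open>\<rho>B\<close> as channel input, the two coefficients that must be
    invertible are the off-diagonal entries of \<open>G\<close>; in the even case they are the
    diagonal ones.\<close>
  have odd: "Jfun d n (boxtimes d n G \<rho>A \<rho>B) \<le> Jfun d n \<rho>B" if "odd_pos d G"
    unfolding box couple_commute[of _ _ _ \<rho>A]
    using that by (intro Jfun_couple_le assms det') (auto simp: odd_pos_def)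
  have even: "Jfun d n (boxtimes d n G \<rho>A \<rho>B) \<le> Jfun d n \<rho>A" if "even_pos d G"
    unfolding box using that by (intro Jfun_couple_le assms det) (auto simp: even_pos_def)
  show ?thesis using odd even by (simp add: positive_def)
qed

end
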